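(* Let $q$ be an indeterminate. For any odd positive integer $n$ with $n\equiv 3\pmod 4$, $$\sum_{k=0}^{(n-1)/2}[6k+1]\frac{(q;q^2)_k^3\,(q^{-1};q^4)_k}{(q^4;q^4)_k^3\,(q^{4};q^2)_k}\,q^{k^2+3k}\left(\sum_{j=1}^{k}\frac{q^{2j-1}}{[2j-1]^2}-\sum_{j=1}^{k}\frac{q^{4j}}{[4j]^2}\right)\equiv -\frac{(q^3,q^5;q^4)_{(n+1)/4}}{(q^4;q^4)_{(n+1)/4}^2}\sum_{j=1}^{(n+1)/4}\frac{q^{4j}}{[4j]^2}\pmod{\Phi_n(q)^2}.$$
   Context: For $a$ in the field $\mathbb{Q}(q)$ of rational functions, a base $Q$ (a power of $q$) and an integer $k\ge 0$, the $q$-shifted factorial is $(a;Q)_k=\prod_{j=0}^{k-1}(1-aQ^j)$, with $(a;Q)_0=1$, and $(a_1,a_2;Q)_k=(a_1;Q)_k(a_2;Q)_k$. For a positive integer $m$, the $q$-integer is $[m]=[m]_q=\frac{1-q^m}{1-q}=1+q+\cdots+q^{m-1}$. $\Phi_n(q)=\prod_{1\le k\le n,\ \gcd(n,k)=1}(q-\zeta^k)$, with $\zeta$ a primitive $n$-th root of unity, is the $n$-th cyclotomic polynomial. Empty sums are $0$. For rational functions $A(q),B(q)\in\mathbb{Q}(q)$ and a polynomial $P(q)$, the congruence $A(q)\equiv B(q)\pmod{P(q)}$ means that, when $A(q)-B(q)$ is written in lowest terms as a quotient of polynomials in $\mathbb{Q}[q]$, its numerator is divisible by $P(q)$ (and hence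 its denominator is coprime to $P(q)$). *)

theory Defs
  imports
    "HOL-Computational_Algebra.Computational_Algebra"
    "HOL-Computational_Algebra.Field_as_Ring"
    "HOL-Number_Theory.Cong"
begin

text \<open>
  The field of rational functions in one indeterminate over the rationals is the fraction field
  \<^typ>\<open>rat poly fract\<close>; its generator is the fraction \<open>X / 1\<close>.
\<close>

type_synonym ratfun = "rat poly fract"

definition qvar :: ratfun where
  "qvar = Fract [:0, 1:] 1"

definition qpoch :: "'a::field \<Rightarrow> 'a \<Rightarrow> nat \<Rightarrow> 'a" where
  "qpoch a Q k = (\<Prod>j<k. 1 - a * Q ^ j)"

definition qint :: "'a::field \<Rightarrow> nat \<Rightarrow> 'a" where
  "qint q m = (1 - q ^ m) / (1 - q)"

text \<open>
  \<^const>\<open>quot_of_fract\<close> yields the (normalized) representation in lowest terms, so its first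
  component is the numerator.
\<close>

definition ratfun_cong :: "ratfun \<Rightarrow> ratfun \<Rightarrow> rat poly \<Rightarrow> bool" where
  "ratfun_cong A B P \<longleftrightarrow> P dvd fst (quot_of_fract (A - B))"

lemma ratfun_cong_iff_lowest_terms:
  assumes "A - B = Fract a b" "b \<noteq> 0" "coprime a b"
  shows "ratfun_cong A B P \<longleftrightarrow> P dvd a"
proof -
  define a' b' where "a' = fst (quot_of_fract (A - B))" and "b' = snd (quot_of_fract (A - B))"
  have b': "b' \<noteq> 0" and ab': "Fract a' b' = Fract a b"
    using assms(1) by (simp_all add: a'_def b'_def)
  have cop: "coprime a' b'"
    using quot_of_fract_in_normalized_fracts[of "A - B"]
    by (simp add: a'_def b'_def normalized_fracts_def case_prod_unfold)
  have eq: "a' * b = a * b'"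
    using ab' b' assms(2) by (simp add: eq_fract)
  have "a' dvd a"
    using eq cop by (metis coprime_dvd_mult_left_iff dvd_triv_left)
  moreover have "a dvd a'"
    using eq assms(3) by (metis coprime_dvd_mult_left_iff dvd_triv_left)
  ultimately show ?thesis
    unfolding ratfun_cong_def a'_def[symmetric] by (meson dvd_trans)
qed

text \<open>
  The product defining the cyclotomic polynomial lives in the complex polynomials. The rational
  cyclotomic polynomial is its unique preimage, whose existence is proved below.
\<close>

definition cyclotomic_complex :: "nat \<Rightarrow> complex poly" where
  "cyclotomic_complex n = (\<Prod>k | 1 \<le> k \<and> k \<le> n \<and> coprime n k. [:- (cis (2 * pi / n) ^ k), 1:])"

definition cyclotomic :: "nat \<Rightarrow> rat poly" where
  "cyclotomic n = (THE p. map_poly of_rat p = cyclotomic_complex n)"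

lemma map_poly_of_rat_add:
  "map_poly of_rat (p + r) = map_poly of_rat p + (map_poly of_rat r :: complex poly)"
  by (intro poly_eqI) (simp add: coeff_map_poly of_rat_add)

lemma map_poly_of_rat_mult:
  "map_poly of_rat (p * r) = map_poly of_rat p * (map_poly of_rat r :: complex poly)"
  by (intro poly_eqI) (simp add: coeff_map_poly coeff_mult of_rat_sum of_rat_mult)

lemma map_poly_of_rat_prod:
  "map_poly of_rat (\<Prod>x\<in>A. f x) = (\<Prod>x\<in>A. map_poly of_rat (f x) :: complex poly)"
  by (induction A rule: infinite_finite_induct)
     (simp_all add: map_poly_of_rat_mult flip: one_pCons)

lemma map_poly_of_rat_inject:
  "(map_poly of_rat p :: complex poly) = map_poly of_rat r \<longleftrightarrow> p = r"
  by (simp add: poly_eq_iff coeff_map_poly)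

lemma map_poly_of_rat_cofactor:
  fixes C :: "complex poly"
  assumes "map_poly of_rat a = map_poly of_rat b * C" "b \<noteq> 0"
  shows "C = map_poly of_rat (a div b)"
proof -
  let ?h = "map_poly of_rat :: rat poly \<Rightarrow> complex poly"
  have "?h a = ?h b * ?h (a div b) + ?h (a mod b)"
    by (metis map_poly_of_rat_add map_poly_of_rat_mult mult_div_mod_eq)
  hence eq: "?h b * (C - ?h (a div b)) = ?h (a mod b)"
    using assms(1) by (simp add: algebra_simps)
  have deg: "degree (?h p) = degree p" for p
    by (rule degree_map_poly) auto
  have b0: "?h b \<noteq> 0"
    using assms(2) map_poly_of_rat_inject[of b 0] by simp
  show ?thesis
  proof (rule ccontr)
    assume "C \<noteq> ?h (a div b)"
    hence nz: "C - ?h (a div b) \<noteq> 0"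
      by simp
    hence "?h (a mod b) \<noteq> 0"
      using eq b0 by (metis mult_eq_0_iff)
    hence "a mod b \<noteq> 0"
      by auto
    moreover have "degree b \<le> degree (a mod b)"
      using nz b0 deg degree_mult_eq[OF b0 nz] eq by (metis le_add1)
    ultimately show False
      using degree_mod_less[OF assms(2), of a] by simp
  qed
qed

lemma prod_roots_of_unity:
  assumes "n > 0"
  shows "(\<Prod>j\<in>{1..n}. [:- (cis (2 * pi / n) ^ j), 1:]) = monom 1 n - 1"
proof -
  define z where "z = cis (2 * pi / n)"
  have pow: "z ^ j = cis (2 * pi * j / n)" for j
    by (simp add: z_def DeMoivre mult_ac)
  have zn: "z ^ n = 1"
    using assms by (simp add: pow)
  have bij: "bij_betw (\<lambda>k. z ^ k) {..<n} {w. w ^ n = 1}"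
    using bij_betw_roots_unity[OF assms] by (simp add: pow)
  define P where "P = monom (1::complex) n - 1"
  have deg1: "degree (- 1 :: complex poly) < degree (monom (1::complex) n)"
    using assms by (simp add: degree_monom_eq)
  have degP: "degree P = n"
    using degree_add_eq_left[OF deg1] by (simp add: P_def degree_monom_eq)
  have lcP: "lead_coeff P = 1"
    unfolding degP using assms by (simp add: P_def)
  have rootsP: "{w. poly P w = 0} = {w. w ^ n = 1}"
    by (simp add: P_def poly_monom)
  have "rsquarefree P"
  proof (rule ccontr)
    assume "\<not> rsquarefree P"
    then obtain w where "poly P w = 0" "poly (pderiv P) w = 0"
      by (auto simp: rsquarefree_roots)
    thus False
      using assms by (auto simp: P_def poly_monom pderiv_diff pderiv_monom power_0_left split: if_splits)
  qed
  hence "P = (\<Prod>w | w ^ n = 1. [:- w, 1:])"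
    using complex_poly_decompose_rsquarefree[of P] lcP rootsP by simp
  also have "\<dots> = (\<Prod>j<n. [:- (z ^ j), 1:])"
    by (rule prod.reindex_bij_betw[OF bij, symmetric])
  also have "\<dots> = (\<Prod>j\<in>{1..n}. [:- (z ^ j), 1:])"
    by (rule prod.reindex_bij_witness
          [of _ "\<lambda>j. if j = n then 0 else j" "\<lambda>j. if j = 0 then n else j"])
       (use assms zn in auto)
  finally show ?thesis
    by (simp add: P_def z_def)
qed

lemma prod_cyclotomic_complex:
  assumes "n > 0"
  shows "(\<Prod>d | d dvd n. cyclotomic_complex d) = monom 1 n - 1"
proof -
  let ?f = "\<lambda>j. [:- (cis (2 * pi / n) ^ j), 1:]"
  have "monom 1 n - 1 = (\<Prod>j\<in>{1..n}. ?f j)"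
    using prod_roots_of_unity[OF assms] by simp
  also have "\<dots> = (\<Prod>d | d dvd n. \<Prod>j | j \<in> {1..n} \<and> n div gcd j n = d. ?f j)"
    using assms
    by (intro prod.group[symmetric]) (auto intro!: div_dvd_iff_mult[THEN iffD2])
  also have "\<dots> = (\<Prod>d | d dvd n. cyclotomic_complex d)"
  proof (intro prod.cong refl)
    fix d assume "d \<in> {d. d dvd n}"
    then obtain e where n: "n = d * e"
      by auto
    with assms have de: "d > 0" "e > 0"
      by auto
    have cis_eq: "cis (2 * pi / n) ^ (k * e) = cis (2 * pi / d) ^ k" for k
      using de by (simp add: n DeMoivre field_simps)
    have quot: "d * e div gcd (k * e) (d * e) = d \<longleftrightarrow> coprime d k" for k
    proof -
      have "gcd (k * e) (d * e) = gcd k d * e"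
        by (simp add: gcd_mult_distrib_nat mult.commute)
      hence "d * e div gcd (k * e) (d * e) = d div gcd k d"
        using de by simp
      also have "\<dots> = d \<longleftrightarrow> gcd k d = 1"
        using de by (metis div_by_1 dvd_div_eq_mult gcd_dvd2 gcd_pos_nat mult.commute
                           nat_mult_eq_1_iff div_eq_dividend_iff nat_less_le less_one linorder_neqE_nat)
      finally show ?thesis
        by (simp add: coprime_iff_gcd_eq_1 gcd.commute)
    qed
    show "(\<Prod>j | j \<in> {1..n} \<and> n div gcd j n = d. ?f j) = cyclotomic_complex d"
      unfolding cyclotomic_complex_def
    proof (rule prod.reindex_bij_witness[of _ "\<lambda>k. k * e" "\<lambda>j. j div e"])
      fix j assume j: "j \<in> {j. j \<in> {1..n} \<and> n div gcd j n = d}"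
      have "n = gcd j n * d"
        using j by (metis (mono_tags, lifting) dvd_mult_div_cancel gcd_dvd2 mem_Collect_eq)
      hence "e = gcd j n"
        using n de by simp
      hence "e dvd j"
        by (metis gcd_dvd1)
      then obtain k where k: "j = k * e"
        by (metis dvd_div_mult_self)
      show "j div e * e = j"
        using k de by simp
      show "j div e \<in> {k. 1 \<le> k \<and> k \<le> d \<and> coprime d k}"
        using j k de quot[of k] by (auto simp: n)
      show "[:- (cis (2 * pi / d) ^ (j div e)), 1:] = ?f j"
        using k de cis_eq[of k] by simp
    next
      fix k assume k: "k \<in> {k. 1 \<le> k \<and> k \<le> d \<and> coprime d k}"
      show "k * e div e = k"
        using de by simp
      show "k * e \<in> {j. j \<in> {1..n} \<and> n div gcd j n = d}"
        using k de quot[of k] by (auto simp: n)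
    qed
  qed
  finally show ?thesis ..
qed

lemma cyclotomic_complex_nonzero: "cyclotomic_complex n \<noteq> 0"
  by (auto simp: cyclotomic_complex_def)

lemma cyclotomic_complex_rational: "\<exists>p. map_poly of_rat p = cyclotomic_complex n"
proof (induction n rule: less_induct)
  case (less n)
  show ?case
  proof (cases "n = 0")
    case True
    hence empty: "{k. 1 \<le> k \<and> k \<le> n \<and> coprime n k} = {}"
      by auto
    show ?thesis
      unfolding cyclotomic_complex_def empty by (intro exI[of _ 1]) simp
  next
    case False
    define D where "D = {d. d dvd n \<and> d \<noteq> n}"
    have D: "finite D" "{d. d dvd n} = insert n D" "n \<notin> D"
      using False by (auto simp: D_def)
    have "d < n" if "d \<in> D" for d
      using that False by (auto simp: D_def intro: le_neq_trans dvd_imp_le)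
    with less.IH obtain r where r: "\<And>d. d \<in> D \<Longrightarrow> map_poly of_rat (r d) = cyclotomic_complex d"
      by metis
    define b where "b = (\<Prod>d\<in>D. r d)"
    have b: "map_poly of_rat b = (\<Prod>d\<in>D. cyclotomic_complex d)"
      using r by (simp add: b_def map_poly_of_rat_prod)
    hence "map_poly of_rat b \<noteq> (0 :: complex poly)"
      using D(1) cyclotomic_complex_nonzero by simp
    hence b0: "b \<noteq> 0"
      by auto
    have "map_poly of_rat (monom 1 n - 1) = (monom 1 n - 1 :: complex poly)"
      by (intro poly_eqI) (simp add: coeff_map_poly of_rat_diff)
    also have "\<dots> = (\<Prod>d\<in>D. cyclotomic_complex d) * cyclotomic_complex n"
      using prod_cyclotomic_complex[of n] False D by (simp add: mult.commute)
    finally have "map_poly of_rat (monom 1 n - 1) = map_poly of_rat b * cyclotomic_complex n"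
      by (simp add: b)
    from map_poly_of_rat_cofactor[OF this b0] show ?thesis
      by metis
  qed
qed

lemma map_poly_cyclotomic: "map_poly of_rat (cyclotomic n) = cyclotomic_complex n"
  unfolding cyclotomic_def
  by (rule theI') (metis cyclotomic_complex_rational map_poly_of_rat_inject)

end

theory Submission
  imports Defs
begin

text \<open>
  Put \<open>n = 2m + 1 = 4M - 1\<close> and \<open>L(y) = (1 - y)\<^sup>2 - x y\<close>, which is \<open>(1 - a y) (1 - y / a)\<close> for
  \<open>x = (a - 1)\<^sup>2 / a\<close>. Replacing the squares \<open>(1 - q\<^bsup>2j-1\<^esup>)\<^sup>2\<close> and \<open>(1 - q\<^bsup>4j\<^esup>)\<^sup>2\<close> inside the cubes of the
  summand by \<open>L(q\<^bsup>2j-1\<^esup>)\<close> and \<open>L(q\<^bsup>4j\<^esup>)\<close> introduces a parameter \<open>x\<close>, and the harmonic sums of the theorem are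
  what differentiation at \<open>x = 0\<close> produces. So the theorem comes from the linear coefficient in \<open>x\<close> of a simpler
  congruence without harmonic sums.

  For the simpler congruence, a second parameter \<open>e\<close> is inserted such that \<open>e = q\<close> is the case of interest. The
  resulting sum \<open>S(e)\<close> over \<open>k \<le> m\<close> obeys, up to an explicit boundary term, the recurrence
  \<open>L(e q\<^sup>4) S(e q\<^sup>4) = (1 - e q\<^sup>3) (1 - e q\<^sup>5) S(e)\<close> (\<open>wz_telescoping\<close>). It is used twice.

  For \<open>e = 1, q\<^sup>4, q\<^sup>8, \<dots>\<close> the boundary term is zero, and \<open>S(q\<^bsup>4M\<^esup>)\<close> is a product
  (\<open>terminating_quadratic_sum\<close>).

  For general \<open>e\<close> the boundary term is divisible by \<open>\<Phi>\<^sub>n\<close>. Modulo \<open>\<Phi>\<^sub>n\<close> the zero \<open>e q\<^sup>4 = 1 / a\<close> of \<open>L\<close> forces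
  \<open>S(e)\<close> to vanish at \<open>1 / (a q\<^sup>4)\<close>, and then, by the recurrence, at \<open>1 / (a q\<^sup>8)\<close>, \<open>1 / (a q\<^bsup>12\<^esup>)\<close> and so on.
  Cleared of denominators, \<open>S\<close> is a polynomial of degree at most \<open>m\<close> in \<open>e\<close>, so it is divisible by \<open>\<Phi>\<^sub>n\<close>
  identically in \<open>e\<close> (\<open>sum_poly_coeffs\<close>).

  Finally \<open>4M = n + 1\<close>, so \<open>q\<close> and \<open>q\<^bsup>4M\<^esup>\<close> differ by \<open>q (1 - q\<^sup>n)\<close>, a multiple of \<open>\<Phi>\<^sub>n\<close>. A polynomial
  in \<open>e\<close> with all coefficients divisible by \<open>\<Phi>\<^sub>n\<close> changes only by a multiple of \<open>\<Phi>\<^sub>n\<^sup>2\<close> between these two arguments, and \<open>S(q)\<close> is congruent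
  to the product modulo \<open>\<Phi>\<^sub>n\<^sup>2\<close> (\<open>parametric_congruence\<close>).

  The parameter \<open>x\<close> need not be an indeterminate. All of this is done for \<open>a = 2, 3, \<dots>\<close>, and the coefficients
  in \<open>x\<close> are recovered by interpolation (\<open>coeffs_difference_poly\<close>).
\<close>

section \<open>A recurrence and a terminating quadratic summation\<close>

text \<open>
  For \<open>x = (a - 1)\<^sup>2 / a\<close> this is \<open>(1 - a y) (1 - y / a)\<close>. Written in terms of \<open>x\<close>, the symmetric pair of
  factors is linear in the parameter, and the value at \<open>a = 1\<close> becomes the value at \<open>x = 0\<close>.
\<close>

definition quad_factor :: "'a::comm_ring_1 \<Rightarrow> 'a \<Rightarrow> 'a" where
  "quad_factor x y = (1 - y) ^ 2 - x * y"

lemma quad_factor_split: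
  fixes a y :: "'a::field"
  assumes "a \<noteq> 0"
  shows "quad_factor ((a - 1) ^ 2 / a) y = (1 - a * y) * (1 - y / a)"
  using assms by (simp add: quad_factor_def field_simps power2_eq_square)

definition base_coeff :: "'a::field \<Rightarrow> nat \<Rightarrow> 'a" where
  "base_coeff q k = (1 - q ^ (6 * k + 1)) * qpoch q (q ^ 2) k / qpoch (q ^ 4) (q ^ 4) k * q ^ (k ^ 2 + 2 * k)"

text \<open>
  The summand of a limiting case of the quadratic summation of Gasper and Rahman. Compared with their
  notation, \<open>e\<close> is the reciprocal of a numerator parameter; this keeps the factors
  \<open>e - q\<^bsup>4j\<^esup>\<close> and \<open>1 - e q\<^bsup>2j+3\<^esup>\<close> polynomial in both \<open>q\<close> and \<open>e\<close>. The sum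
  breaks off at \<open>k = M\<close> when \<open>e = q\<^bsup>4M\<^esup>\<close>, and \<open>e = q\<close>, \<open>x = 0\<close> gives, up to the factor \<open>1 - q\<close>,
  the summand of the theorem without the inner harmonic sums.
\<close>

definition quad_term :: "'a::field \<Rightarrow> 'a \<Rightarrow> 'a \<Rightarrow> nat \<Rightarrow> 'a" where
  "quad_term q x e k = base_coeff q k
     * ((\<Prod>j<k. quad_factor x (q ^ (2 * j + 1))) / (\<Prod>j<k. quad_factor x (q ^ (4 * j + 4))))
     * ((\<Prod>j<k. e - q ^ (4 * j)) / (\<Prod>j<k. 1 - e * q ^ (2 * j + 3)))"

definition wz_boundary :: "'a::field \<Rightarrow> 'a \<Rightarrow> 'a \<Rightarrow> nat \<Rightarrow> 'a" where
  "wz_boundary q x e j = e * qpoch q (q ^ 2) (Suc j) / qpoch (q ^ 4) (q ^ 4) j * q ^ ((j + 1) ^ 2 + 2 * (j + 1))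
     * ((\<Prod>i<Suc j. quad_factor x (q ^ (2 * i + 1))) / (\<Prod>i<j. quad_factor x (q ^ (4 * i + 4))))
     * ((\<Prod>i<j. e - q ^ (4 * i)) / (\<Prod>i<j. 1 - e * q ^ (2 * i + 7)))"

text \<open>
  What remains of one step of the telescoping after all common factors are cancelled, with \<open>J = q\<^sup>j\<close>.
\<close>

lemma wz_certificate:
  fixes q J e x :: "'a::field"
  shows "(1 - q ^ 7 * J ^ 6) * (quad_factor x (e * q ^ 4) * (J ^ 4 * (e * q ^ 4 - 1))
             - (e - J ^ 4) * (1 - e * (q ^ 5 * J ^ 2)) * (1 - e * (q ^ 7 * J ^ 2)))
         = e * (1 - q ^ 3 * J ^ 2) * quad_factor x (q ^ 3 * J ^ 2) * (q ^ 5 * J ^ 2) * (e - J ^ 4)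
           - e * (1 - q ^ 4 * J ^ 4) * quad_factor x (q ^ 4 * J ^ 4) * (1 - e * (q ^ 7 * J ^ 2))"
  unfolding quad_factor_def by algebra

lemma prod_shift_four:
  fixes q e :: "'a::comm_ring_1"
  shows "(\<Prod>i<Suc j. e * q ^ 4 - q ^ (4 * i)) = (e * q ^ 4 - 1) * q ^ (4 * j) * (\<Prod>i<j. e - q ^ (4 * i))"
proof (induction j)
  case (Suc j)
  have pw: "q ^ (4 * Suc j) = q ^ (4 * j) * q ^ 4"
    by (simp add: add.commute flip: power_add)
  have "(\<Prod>i<Suc (Suc j). e * q ^ 4 - q ^ (4 * i))
        = (e * q ^ 4 - 1) * q ^ (4 * j) * (\<Prod>i<j. e - q ^ (4 * i)) * (e * q ^ 4 - q ^ (4 * Suc j))"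
    by (subst prod.lessThan_Suc) (simp only: Suc)
  also note pw
  finally have "(\<Prod>i<Suc (Suc j). e * q ^ 4 - q ^ (4 * i))
        = (e * q ^ 4 - 1) * q ^ (4 * j) * (\<Prod>i<j. e - q ^ (4 * i)) * (e * q ^ 4 - q ^ (4 * j) * q ^ 4)" .
  then show ?case
    unfolding pw prod.lessThan_Suc[of "\<lambda>i. e - q ^ (4 * i)"] by (simp only: algebra_simps)
qed simp

lemma prod_shift_two:
  fixes q e :: "'a::comm_ring_1"
  shows "(1 - e * q ^ 3) * (1 - e * q ^ 5) * (\<Prod>i<j. 1 - e * q ^ (2 * i + 7))
         = (\<Prod>i<j. 1 - e * q ^ (2 * i + 3)) * (1 - e * q ^ (2 * j + 3)) * (1 - e * q ^ (2 * j + 5))"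
proof (induction j)
  case (Suc j)
  have "(1 - e * q ^ 3) * (1 - e * q ^ 5) * (\<Prod>i<Suc j. 1 - e * q ^ (2 * i + 7))
        = ((1 - e * q ^ 3) * (1 - e * q ^ 5) * (\<Prod>i<j. 1 - e * q ^ (2 * i + 7))) * (1 - e * q ^ (2 * j + 7))"
    by (simp add: mult.assoc)
  also note Suc
  finally have "(1 - e * q ^ 3) * (1 - e * q ^ 5) * (\<Prod>i<Suc j. 1 - e * q ^ (2 * i + 7))
        = (\<Prod>i<j. 1 - e * q ^ (2 * i + 3)) * (1 - e * q ^ (2 * j + 3)) * (1 - e * q ^ (2 * j + 5)) * (1 - e * q ^ (2 * j + 7))" .
  moreover have idx: "2 * Suc j + 3 = 2 * j + 5" "2 * Suc j + 5 = 2 * j + 7"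
    by simp_all
  ultimately show ?case
    by (simp only: idx prod.lessThan_Suc mult_ac)
qed simp

text \<open>
  Creative telescoping in the style of Wilf and Zeilberger: the sums at \<open>e q\<^sup>4\<close> and at \<open>e\<close> satisfy a
  first-order recurrence, because this combination of the two summands is the difference of two consecutive
  values of \<open>wz_boundary\<close>. The boundary term is explicit, so the recurrence is usable whenever that term
  vanishes, exactly or in a suitable ideal.
\<close>

lemma wz_telescoping:
  fixes q x e :: "'a::field"
  assumes q: "\<And>j. q ^ (4 * j + 4) \<noteq> 1"
    and x: "\<And>j. quad_factor x (q ^ (4 * j + 4)) \<noteq> 0"
    and e: "\<And>j. e * q ^ (2 * j + 3) \<noteq> 1"
  shows "(\<Sum>k\<le>m. quad_factor x (e * q ^ 4) * quad_term q x (e * q ^ 4) k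
              - (1 - e * q ^ 3) * (1 - e * q ^ 5) * quad_term q x e k) = wz_boundary q x e m"
proof (induction m)
  case 0
  show ?case
    unfolding quad_factor_def
    by (simp add: quad_term_def wz_boundary_def base_coeff_def qpoch_def quad_factor_def) algebra
next
  case (Suc j)
  (* B collects the factors that the two summands and the two boundary terms have in common. *)
  define B where "B = qpoch q (q ^ 2) (Suc j) / qpoch (q ^ 4) (q ^ 4) j * q ^ ((j + 1) ^ 2 + 2 * (j + 1))
     * ((\<Prod>i<Suc j. quad_factor x (q ^ (2 * i + 1))) / (\<Prod>i<j. quad_factor x (q ^ (4 * i + 4))))
     * ((\<Prod>i<j. e - q ^ (4 * i)) / (\<Prod>i<j. 1 - e * q ^ (2 * i + 7)))"
  define J where "J = q ^ j"
  define u where "u = 1 - q ^ 4 * J ^ 4"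
  define v where "v = quad_factor x (q ^ 4 * J ^ 4)"
  define w where "w = 1 - e * (q ^ 7 * J ^ 2)"
  have idx: "6 * Suc j + 1 = 6 * j + 7" "2 * Suc j + 1 = 2 * j + 3"
    by simp_all
  have J: "q ^ (4 * j) = J ^ 4" "q ^ (4 * j + 4) = q ^ 4 * J ^ 4" "q ^ (2 * j + 3) = q ^ 3 * J ^ 2"
    "q ^ (2 * j + 5) = q ^ 5 * J ^ 2" "q ^ (2 * j + 7) = q ^ 7 * J ^ 2"
    "q ^ (6 * Suc j + 1) = q ^ 7 * J ^ 6" "q ^ (2 * Suc j + 1) = q ^ 3 * J ^ 2"
    "q ^ (2 * j) = J ^ 2"
    unfolding idx by (simp_all add: J_def power_mult[symmetric] power_add[symmetric] ac_simps)
  have nz: "u \<noteq> 0" "v \<noteq> 0" "w \<noteq> 0"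
    using q[of j] x[of j] e[of "j + 2"] J by (auto simp: u_def v_def w_def add.commute)
  have Qd: "qpoch (q ^ 4) (q ^ 4) (Suc j) = qpoch (q ^ 4) (q ^ 4) j * u"
    using J by (simp add: qpoch_def u_def flip: power_mult)
  have Q: "qpoch q (q ^ 2) (Suc (Suc j)) = qpoch q (q ^ 2) (Suc j) * (1 - q ^ 3 * J ^ 2)"
    using J by (simp add: qpoch_def flip: power_mult power_Suc)
  have vD: "(\<Prod>j<Suc j. quad_factor x (q ^ (4 * j + 4))) = (\<Prod>i<j. quad_factor x (q ^ (4 * i + 4))) * v"
    by (simp only: prod.lessThan_Suc J v_def)
  have shift2: "(1 - e * q ^ 3) * (1 - e * q ^ 5) / (\<Prod>i<Suc j. 1 - e * q ^ (2 * i + 3))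
                = (1 - e * (q ^ 5 * J ^ 2)) / (\<Prod>i<j. 1 - e * q ^ (2 * i + 7))"
  proof -
    have e7: "e * q ^ (2 * i + 7) \<noteq> 1" for i
      using e[of "i + 2"] by (simp add: add.commute)
    have nz0: "(\<Prod>i<Suc j. 1 - e * q ^ (2 * i + 3)) \<noteq> 0" "(\<Prod>i<j. 1 - e * q ^ (2 * i + 7)) \<noteq> 0"
      using e e7 by (auto simp: eq_commute[of 1])
    show ?thesis
      using prod_shift_two[of e q j] nz0 unfolding J(4)[symmetric] by (simp add: frac_eq_eq mult_ac)
  qed
  have t1: "quad_term q x (e * q ^ 4) (Suc j)
        = B * ((1 - q ^ 7 * J ^ 6) * (J ^ 4 * (e * q ^ 4 - 1)) / (u * v * w))"
  proof -
    have den: "(\<Prod>i<Suc j. 1 - e * q ^ 4 * q ^ (2 * i + 3)) = (\<Prod>i<j. 1 - e * q ^ (2 * i + 7)) * w"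
      using J by (simp add: w_def mult.assoc flip: power_add) (simp add: add.commute)
    show ?thesis
      unfolding quad_term_def base_coeff_def den prod_shift_four Qd vD J B_def
      by (simp only: divide_inverse inverse_mult_distrib mult_ac Suc_eq_plus1[symmetric])
  qed
  have t2: "(1 - e * q ^ 3) * (1 - e * q ^ 5) * quad_term q x e (Suc j)
        = B * ((1 - q ^ 7 * J ^ 6) * ((e - J ^ 4) * (1 - e * (q ^ 5 * J ^ 2)) * w) / (u * v * w))"
  proof -
    have eD: "(\<Prod>i<Suc j. e - q ^ (4 * i)) = (\<Prod>i<j. e - q ^ (4 * i)) * (e - J ^ 4)"
      using J by simp
    have "(1 - e * q ^ 3) * (1 - e * q ^ 5) * quad_term q x e (Suc j)
        = (1 - q ^ 7 * J ^ 6) * qpoch q (q ^ 2) (Suc j) / (qpoch (q ^ 4) (q ^ 4) j * u) * q ^ ((j + 1) ^ 2 + 2 * (j + 1))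
     * ((\<Prod>i<Suc j. quad_factor x (q ^ (2 * i + 1))) / ((\<Prod>i<j. quad_factor x (q ^ (4 * i + 4))) * v))
     * ((\<Prod>i<j. e - q ^ (4 * i)) * (e - J ^ 4))
     * ((1 - e * q ^ 3) * (1 - e * q ^ 5) / (\<Prod>i<Suc j. 1 - e * q ^ (2 * i + 3)))"
      unfolding quad_term_def base_coeff_def Qd vD eD J by (simp only: divide_inverse inverse_mult_distrib mult_ac Suc_eq_plus1[symmetric])
    also have "\<dots> = B * ((1 - q ^ 7 * J ^ 6) * ((e - J ^ 4) * (1 - e * (q ^ 5 * J ^ 2))) / (u * v))"
      unfolding shift2 B_def by (simp only: divide_inverse inverse_mult_distrib mult_ac Suc_eq_plus1[symmetric])
    finally show ?thesis
      using nz by simp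
  qed
  have g1: "wz_boundary q x e j = B * (e * u * v * w / (u * v * w))"
    using nz by (simp add: wz_boundary_def B_def)
  have g2: "wz_boundary q x e (Suc j)
      = B * (e * (1 - q ^ 3 * J ^ 2) * quad_factor x (q ^ 3 * J ^ 2) * (q ^ 5 * J ^ 2) * (e - J ^ 4) / (u * v * w))"
  proof -
    have "(Suc j + 1) ^ 2 + 2 * (Suc j + 1) = ((j + 1) ^ 2 + 2 * (j + 1)) + (2 * j + 5)"
      by (simp add: power2_eq_square)
    then have "q ^ ((Suc j + 1) ^ 2 + 2 * (Suc j + 1)) = q ^ ((j + 1) ^ 2 + 2 * (j + 1)) * (q ^ 5 * J ^ 2)"
      by (simp only: power_add[of q "(j + 1) ^ 2 + 2 * (j + 1)" "2 * j + 5"] J)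
    moreover have "(\<Prod>i<Suc (Suc j). quad_factor x (q ^ (2 * i + 1)))
       = (\<Prod>i<Suc j. quad_factor x (q ^ (2 * i + 1))) * quad_factor x (q ^ 3 * J ^ 2)"
      by (subst prod.lessThan_Suc) (simp only: J)
    moreover have "(\<Prod>i<Suc j. e - q ^ (4 * i)) = (\<Prod>i<j. e - q ^ (4 * i)) * (e - J ^ 4)"
      using J by simp
    moreover have "(\<Prod>i<Suc j. 1 - e * q ^ (2 * i + 7)) = (\<Prod>i<j. 1 - e * q ^ (2 * i + 7)) * w"
      by (simp only: prod.lessThan_Suc J w_def)
    ultimately show ?thesis
      unfolding wz_boundary_def Q Qd vD B_def by (simp only: divide_inverse inverse_mult_distrib mult_ac Suc_eq_plus1[symmetric])
  qed
  have collect: "l * (B * (a / d)) - B * (b / d) = B * (c / d) - B * (f / d)"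
    if "l * a - b = c - f" for a b c d f l :: 'a
  proof -
    have "l * (B * (a / d)) - B * (b / d) = B * ((l * a - b) / d)"
      by (simp add: right_diff_distrib diff_divide_distrib)
    then show ?thesis
      by (simp add: that right_diff_distrib diff_divide_distrib)
  qed
  have "quad_factor x (e * q ^ 4) * quad_term q x (e * q ^ 4) (Suc j)
        - (1 - e * q ^ 3) * (1 - e * q ^ 5) * quad_term q x e (Suc j)
      = wz_boundary q x e (Suc j) - wz_boundary q x e j"
    unfolding t1 t2 g1 g2
    using wz_certificate[of q J x e, folded u_def v_def w_def]
    by (intro collect) (simp only: algebra_simps)
  then show ?case
    using Suc by (simp add: algebra_simps)
qed

text \<open>
  Starting from \<open>e = 1\<close>, where only the summand for \<open>k = 0\<close> survives, \<open>M\<close> steps of the recurrence lead to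
  \<open>e = q\<^bsup>4M\<^esup>\<close>. At each step the boundary term contains the factor \<open>e - q\<^bsup>4i\<^esup>\<close> that is zero.
\<close>

lemma terminating_quadratic_sum:
  fixes q x :: "'a::field"
  assumes q: "\<And>j. j > 0 \<Longrightarrow> q ^ j \<noteq> 1"
    and x: "\<And>j. quad_factor x (q ^ (4 * j + 4)) \<noteq> 0"
  shows "M \<le> m \<Longrightarrow> (\<Sum>k\<le>m. quad_term q x (q ^ (4 * M)) k)
     = (1 - q) * (\<Prod>j<M. (1 - q ^ (4 * j + 3)) * (1 - q ^ (4 * j + 5)) / quad_factor x (q ^ (4 * j + 4)))"
proof (induction M)
  case 0
  have "quad_term q x 1 k = 0" if "k > 0" for k
  proof -
    have "(\<Prod>j<k. 1 - q ^ (4 * j)) = 0"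
      using that by (intro prod_zero bexI[of _ 0]) auto
    then show ?thesis by (simp add: quad_term_def)
  qed
  then have "(\<Sum>k\<le>m. quad_term q x 1 k) = (\<Sum>k\<in>{0}. quad_term q x 1 k)"
    by (intro sum.mono_neutral_right) auto
  then show ?case
    by (simp add: quad_term_def base_coeff_def qpoch_def)
next
  case (Suc M)
  let ?S = "\<lambda>e. \<Sum>k\<le>m. quad_term q x e k"
  let ?e = "q ^ (4 * M)"
  have "(\<Prod>i<m. ?e - q ^ (4 * i)) = 0"
    using Suc.prems by (intro prod_zero) auto
  then have "wz_boundary q x ?e m = 0"
    by (simp add: wz_boundary_def)
  moreover have "?e * q ^ (2 * j + 3) \<noteq> 1" for j
    using q[of "4 * M + (2 * j + 3)"] by (simp add: power_add)
  ultimately have "quad_factor x (?e * q ^ 4) * ?S (?e * q ^ 4) = (1 - ?e * q ^ 3) * (1 - ?e * q ^ 5) * ?S ?e"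
    using wz_telescoping[of q x ?e m] q x by (simp add: sum_subtractf sum_distrib_left)
  moreover have "?e * q ^ 4 = q ^ (4 * Suc M)" "?e * q ^ 4 = q ^ (4 * M + 4)" "?e * q ^ 3 = q ^ (4 * M + 3)" "?e * q ^ 5 = q ^ (4 * M + 5)"
    by (simp_all flip: power_add add: add.commute)
  moreover have cancel: "X = Y * (a * b / l)" if "l * X = a * b * Y" "l \<noteq> 0" for X Y a b l :: 'a
    using that by (simp add: field_simps)
  ultimately have "?S (q ^ (4 * Suc M)) = ?S ?e * ((1 - q ^ (4 * M + 3)) * (1 - q ^ (4 * M + 5)) / quad_factor x (q ^ (4 * M + 4)))"
    using x[of M] cancel by metis
  then show ?case
    using Suc by simp
qed

section \<open>Rational functions with denominator coprime to a polynomial\<close>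

definition localized :: "rat poly \<Rightarrow> ratfun set" where
  "localized P = {Fract a b | a b. b \<noteq> 0 \<and> coprime b P}"

lemma localized_Fract: "b \<noteq> 0 \<Longrightarrow> coprime b P \<Longrightarrow> Fract a b \<in> localized P"
  by (auto simp: localized_def)

lemma localized_poly: "Fract a 1 \<in> localized P"
  by (rule localized_Fract) auto

lemma localized_add: "f \<in> localized P \<Longrightarrow> g \<in> localized P \<Longrightarrow> f + g \<in> localized P"
  unfolding localized_def mem_Collect_eq by (metis add_fract coprime_mult_left_iff mult_eq_0_iff)

lemma localized_mult: "f \<in> localized P \<Longrightarrow> g \<in> localized P \<Longrightarrow> f * g \<in> localized P"
  unfolding localized_def mem_Collect_eq by (metis mult_fract coprime_mult_left_iff mult_eq_0_iff)

lemma localized_uminus: "f \<in> localized P \<Longrightarrow> - f \<in> localized P"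
  unfolding localized_def mem_Collect_eq by (metis minus_fract)

lemma localized_of_nat: "of_nat a \<in> localized P"
  using localized_poly by (metis Fract_of_nat_eq)

lemma localized_0: "0 \<in> localized P" and localized_1: "1 \<in> localized P"
  using localized_of_nat[of 0] localized_of_nat[of 1] by simp_all

lemma localized_diff: "f \<in> localized P \<Longrightarrow> g \<in> localized P \<Longrightarrow> f - g \<in> localized P"
  using localized_add localized_uminus by (metis diff_conv_add_uminus)

lemma localized_power: "f \<in> localized P \<Longrightarrow> f ^ k \<in> localized P"
  by (induction k) (auto intro: localized_mult localized_1)

lemma localized_sum: "(\<And>i. i \<in> A \<Longrightarrow> f i \<in> localized P) \<Longrightarrow> sum f A \<in> localized P"
  by (induction A rule: infinite_finite_induct) (auto intro: localized_add localized_0)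

lemma localized_prod: "(\<And>i. i \<in> A \<Longrightarrow> f i \<in> localized P) \<Longrightarrow> prod f A \<in> localized P"
  by (induction A rule: infinite_finite_induct) (auto intro: localized_mult localized_1)

definition local_units :: "rat poly \<Rightarrow> ratfun set" where
  "local_units P = {f. f \<noteq> 0 \<and> f \<in> localized P \<and> inverse f \<in> localized P}"

lemma local_unit_nonzero: "f \<in> local_units P \<Longrightarrow> f \<noteq> 0"
  and local_unit_localized: "f \<in> local_units P \<Longrightarrow> f \<in> localized P"
  by (auto simp: local_units_def)

lemma local_unit_inverse: "f \<in> local_units P \<Longrightarrow> inverse f \<in> local_units P"
  by (auto simp: local_units_def)

lemma local_unit_1: "1 \<in> local_units P"
  by (simp add: local_units_def localized_1)

lemma local_unit_mult: "f \<in> local_units P \<Longrightarrow> g \<in> local_units P \<Longrightarrow> f * g \<in> local_units P"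
  by (auto simp: local_units_def intro: localized_mult)

lemma local_unit_uminus: "f \<in> local_units P \<Longrightarrow> - f \<in> local_units P"
  by (auto simp: local_units_def intro: localized_uminus)

lemma local_unit_power: "f \<in> local_units P \<Longrightarrow> f ^ k \<in> local_units P"
  by (induction k) (auto intro: local_unit_mult local_unit_1)

lemma local_unit_prod: "(\<And>i. i \<in> A \<Longrightarrow> f i \<in> local_units P) \<Longrightarrow> prod f A \<in> local_units P"
  by (induction A rule: infinite_finite_induct) (auto intro: local_unit_mult local_unit_1)

lemma local_unit_divide: "f \<in> local_units P \<Longrightarrow> g \<in> local_units P \<Longrightarrow> f / g \<in> local_units P"
  by (simp add: divide_inverse local_unit_mult local_unit_inverse)

lemma localized_divide: "f \<in> localized P \<Longrightarrow> g \<in> local_units P \<Longrightarrow> f / g \<in> localized P"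
  by (auto simp: divide_inverse local_units_def intro: localized_mult)

lemma local_unit_poly: "p \<noteq> 0 \<Longrightarrow> coprime p P \<Longrightarrow> Fract p 1 \<in> local_units P"
  by (auto simp: local_units_def Zero_fract_def eq_fract intro: localized_Fract localized_poly)

text \<open>
  The ideal generated by \<open>P\<^sup>r\<close> in the ring of fractions with denominator coprime to \<open>P\<close>. Congruence of
  rational functions modulo \<open>P\<^sup>r\<close>, for \<open>r \<ge> 1\<close>, is membership of the difference in this ideal.
\<close>

definition power_ideal :: "rat poly \<Rightarrow> nat \<Rightarrow> ratfun set" where
  "power_ideal P r = {Fract P 1 ^ r * f | f. f \<in> localized P}"

lemma power_ideal_add: "f \<in> power_ideal P r \<Longrightarrow> g \<in> power_ideal P r \<Longrightarrow> f + g \<in> power_ideal P r"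
  unfolding power_ideal_def mem_Collect_eq by (metis distrib_left localized_add)

lemma power_ideal_mult: "f \<in> power_ideal P r \<Longrightarrow> g \<in> power_ideal P s \<Longrightarrow> f * g \<in> power_ideal P (r + s)"
proof -
  assume "f \<in> power_ideal P r" "g \<in> power_ideal P s"
  then obtain u v where u: "f = Fract P 1 ^ r * u" "u \<in> localized P" and v: "g = Fract P 1 ^ s * v" "v \<in> localized P"
    by (auto simp: power_ideal_def)
  then have "f * g = Fract P 1 ^ (r + s) * (u * v)"
    by (simp add: power_add)
  then show ?thesis
    using localized_mult[OF u(2) v(2)] unfolding power_ideal_def by blast
qed

lemma power_ideal_0: "power_ideal P 0 = localized P"
  by (auto simp: power_ideal_def)

lemma power_ideal_mult_right: "f \<in> power_ideal P r \<Longrightarrow> g \<in> localized P \<Longrightarrow> f * g \<in> power_ideal P r"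
  using power_ideal_mult[of f P r g 0] by (simp add: power_ideal_0)

lemma power_ideal_mult_left: "g \<in> localized P \<Longrightarrow> f \<in> power_ideal P r \<Longrightarrow> g * f \<in> power_ideal P r"
  using power_ideal_mult_right by (simp add: mult.commute)

lemma zero_in_power_ideal: "0 \<in> power_ideal P r"
  using localized_0 by (auto simp: power_ideal_def)

lemma power_ideal_uminus: "f \<in> power_ideal P r \<Longrightarrow> - f \<in> power_ideal P r"
  using power_ideal_mult_left[of "- 1" P f r] by (simp add: localized_uminus localized_1)

lemma power_ideal_diff: "f \<in> power_ideal P r \<Longrightarrow> g \<in> power_ideal P r \<Longrightarrow> f - g \<in> power_ideal P r"
  using power_ideal_add power_ideal_uminus by (metis diff_conv_add_uminus)

lemma power_ideal_divide: "f \<in> power_ideal P r \<Longrightarrow> g \<in> local_units P \<Longrightarrow> f / g \<in> power_ideal P r"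
  by (auto simp: divide_inverse local_units_def intro: power_ideal_mult_right)

lemma power_ideal_sum: "(\<And>i. i \<in> A \<Longrightarrow> f i \<in> power_ideal P r) \<Longrightarrow> sum f A \<in> power_ideal P r"
  by (induction A rule: infinite_finite_induct) (auto intro: power_ideal_add zero_in_power_ideal)

text \<open>
  Going to lowest terms only cancels factors that are coprime to \<open>P\<close>, so it leaves the factor \<open>P\<^sup>r\<close> in the
  numerator.
\<close>

lemma power_ideal_imp_cong:
  assumes "A - B \<in> power_ideal P r" "P \<noteq> 0"
  shows "ratfun_cong A B (P ^ r)"
proof -
  obtain a b where b: "b \<noteq> 0" "coprime b P" and "A - B = Fract P 1 ^ r * Fract a b"
    using assms by (auto simp: power_ideal_def localized_def)
  moreover have "Fract P 1 ^ r = Fract (P ^ r) 1"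
    by (induction r) (auto simp: One_fract_def)
  ultimately have eq: "A - B = Fract (P ^ r * a) b"
    by simp
  define a' b' where "a' = fst (quot_of_fract (A - B))" and "b' = snd (quot_of_fract (A - B))"
  have "b' \<noteq> 0" "Fract a' b' = A - B"
    by (simp_all add: a'_def b'_def)
  then have "a' * b = P ^ r * a * b'"
    using b eq by (simp add: eq_fract)
  then have "P ^ r dvd a' * b"
    by simp
  then have "P ^ r dvd a'"
    using b by (simp add: coprime_commute coprime_dvd_mult_left_iff)
  then show ?thesis
    by (simp add: ratfun_cong_def a'_def)
qed

section \<open>Interpolation with values in an ideal\<close>

text \<open>
  Newton interpolation. A polynomial with at most as many coefficients as there are points is obtained from
  its values by divided differences, and these stay in the ideal because the differences of the points are units.
  It converts a statement about many values of a parameter into one about formal coefficients.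
\<close>

lemma coeffs_in_power_ideal:
  fixes p :: "ratfun poly"
  assumes "\<And>i. i < N \<Longrightarrow> y i \<in> localized P"
    and "\<And>i j. i < N \<Longrightarrow> j < N \<Longrightarrow> i \<noteq> j \<Longrightarrow> y i - y j \<in> local_units P"
    and "\<And>i. i < N \<Longrightarrow> poly p (y i) \<in> power_ideal P r"
    and "\<And>i. i \<ge> N \<Longrightarrow> coeff p i = 0"
  shows "coeff p i \<in> power_ideal P r"
  using assms
proof (induction N arbitrary: p i)
  case 0
  then show ?case by (simp add: zero_in_power_ideal)
next
  case (Suc N)
  define s where "s = synthetic_div p (y N)"
  define v where "v = poly p (y N)"
  have p: "p = [:- y N, 1:] * s + [:v:]"
    unfolding s_def v_def by (rule synthetic_div_correct'[symmetric])
  have s: "coeff s i \<in> power_ideal P r" for i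
  proof (rule Suc.IH)
    fix i assume i: "i < N"
    then have u: "y i - y N \<in> local_units P"
      using Suc.prems(2)[of i N] by simp
    have "poly p (y i) - v = (y i - y N) * poly s (y i)"
      by (subst p) (simp add: algebra_simps)
    then have "poly s (y i) = (poly p (y i) - v) / (y i - y N)"
      using local_unit_nonzero[OF u] by simp
    also have "\<dots> \<in> power_ideal P r"
      using u i Suc.prems(3) by (auto simp: v_def intro!: power_ideal_divide power_ideal_diff)
    finally show "poly s (y i) \<in> power_ideal P r" .
  next
    fix i assume "i \<ge> N"
    have "degree p \<le> N"
      using Suc.prems(4) by (intro degree_le) auto
    then have "degree s \<le> N - 1"
      by (simp add: s_def degree_synthetic_div)
    show "coeff s i = 0"
    proof (cases "N = 0")
      case True
      then have "degree p = 0" using \<open>degree p \<le> N\<close> by simp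
      then have "s = 0" by (simp add: s_def synthetic_div_eq_0_iff)
      then show ?thesis by simp
    next
      case False
      then show ?thesis
        using \<open>degree s \<le> N - 1\<close> \<open>i \<ge> N\<close> by (intro coeff_eq_0) auto
    qed
  qed (use Suc.prems in auto)
  have y: "y N \<in> localized P" and v: "v \<in> power_ideal P r"
    using Suc.prems by (auto simp: v_def)
  have "coeff p i = - y N * coeff s i + (case i of 0 \<Rightarrow> v | Suc k \<Rightarrow> coeff s k)"
    by (subst p) (simp add: algebra_simps coeff_pCons split: nat.split)
  moreover have "(case i of 0 \<Rightarrow> v | Suc k \<Rightarrow> coeff s k) \<in> power_ideal P r"
    using s v by (cases i) auto
  moreover have "- y N * coeff s i \<in> power_ideal P r"
    using s y by (intro power_ideal_mult_left localized_uminus)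
  ultimately show ?case
    by (simp only: power_ideal_add)
qed

text \<open>
  This is where the second power of the modulus comes from: one factor is contributed by the coefficients, the
  other by the distance of the two arguments.
\<close>

lemma poly_diff_in_power_ideal:
  fixes p :: "ratfun poly"
  assumes "\<And>i. coeff p i \<in> power_ideal P r" "y \<in> localized P" "z \<in> localized P" "y - z \<in> power_ideal P s"
  shows "poly p y - poly p z \<in> power_ideal P (r + s)"
proof -
  have pow: "y ^ i - z ^ i \<in> power_ideal P s" for i
  proof (induction i)
    case (Suc i)
    have "y ^ Suc i - z ^ Suc i = y * (y ^ i - z ^ i) + (y - z) * z ^ i"
      by (simp add: algebra_simps)
    then show ?case
      using Suc assms by (auto intro: power_ideal_add power_ideal_mult_left power_ideal_mult_right localized_power)
  qed (simp add: zero_in_power_ideal)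
  have "poly p y - poly p z = (\<Sum>i\<le>degree p. coeff p i * (y ^ i - z ^ i))"
    by (simp add: poly_altdef sum_subtractf algebra_simps)
  also have "\<dots> \<in> power_ideal P (r + s)"
    using assms(1) pow by (intro power_ideal_sum power_ideal_mult)
  finally show ?thesis .
qed

lemma poly_in_power_ideal:
  assumes "\<And>i. coeff p i \<in> power_ideal P r" "y \<in> localized P"
  shows "poly p y \<in> power_ideal P r"
  unfolding poly_altdef using assms
  by (intro power_ideal_sum power_ideal_mult_right localized_power)

lemma prod_diff_in_power_ideal:
  fixes f g :: "nat \<Rightarrow> ratfun"
  assumes "\<And>j. f j \<in> localized P" "\<And>j. g j \<in> localized P" "\<And>j. f j - g j \<in> power_ideal P r"
  shows "(\<Prod>j<k. f j) - (\<Prod>j<k. g j) \<in> power_ideal P r"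
proof (induction k)
  case (Suc k)
  have "(\<Prod>j<Suc k. f j) - (\<Prod>j<Suc k. g j)
        = ((\<Prod>j<k. f j) - (\<Prod>j<k. g j)) * f k + (\<Prod>j<k. g j) * (f k - g k)"
    by (simp add: algebra_simps)
  also have "\<dots> \<in> power_ideal P r"
    using Suc assms by (intro power_ideal_add power_ideal_mult_right power_ideal_mult_left localized_prod)
  finally show ?case .
qed (simp add: zero_in_power_ideal)

section \<open>Coprimality with cyclotomic polynomials\<close>

lemma cyclotomic_nonzero: "cyclotomic n \<noteq> 0"
  using map_poly_cyclotomic[of n] cyclotomic_complex_nonzero[of n] by auto

lemma cyclotomic_complex_root:
  assumes "n > 0" "poly (cyclotomic_complex n) z = 0"
  shows "z ^ m = 1 \<longleftrightarrow> n dvd m"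
proof -
  obtain k where k: "coprime n k" and z: "z = cis (2 * pi / n) ^ k"
    using assms(2) by (auto simp: cyclotomic_complex_def poly_prod)
  have bij: "inj_on (\<lambda>k. cis (2 * pi * real k / real n)) {..<n}"
    using bij_betw_roots_unity[OF assms(1)] by (auto simp: bij_betw_def)
  define w where "w = cis (2 * pi / n)"
  have pow: "w ^ j = cis (2 * pi * real j / real n)" for j
    by (simp add: w_def DeMoivre mult_ac)
  have "w ^ n = 1"
    using assms(1) by (simp add: pow)
  have "w ^ j = 1 \<longleftrightarrow> n dvd j" for j
  proof -
    have "w ^ j = w ^ (j mod n + n * (j div n))"
      by simp
    also have "\<dots> = w ^ (j mod n)"
      unfolding power_add power_mult using \<open>w ^ n = 1\<close> by simp
    finally have "w ^ j = w ^ (j mod n)" .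
    moreover have "w ^ (j mod n) = 1 \<longleftrightarrow> j mod n = 0"
      using inj_onD[OF bij, of "j mod n" 0] assms(1) by (auto simp: pow)
    ultimately show ?thesis
      by (simp add: dvd_eq_mod_eq_0)
  qed
  then have "z ^ m = 1 \<longleftrightarrow> n dvd k * m"
    by (simp add: z w_def flip: power_mult)
  then show ?thesis
    using k by (simp add: coprime_dvd_mult_right_iff)
qed

text \<open>
  A nonconstant common divisor would have a complex root, and the complex roots of the cyclotomic polynomial
  are elements of order exactly \<open>n\<close>. In this way coprimality is decided by evaluation.
\<close>

lemma coprime_cyclotomicI:
  assumes "n > 0" "\<And>z::complex. (\<And>m. z ^ m = 1 \<longleftrightarrow> n dvd m) \<Longrightarrow> poly (map_poly of_rat p) z \<noteq> 0"
  shows "coprime p (cyclotomic n)"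
proof (rule coprimeI)
  fix g assume g: "g dvd p" "g dvd cyclotomic n"
  let ?h = "map_poly of_rat :: rat poly \<Rightarrow> complex poly"
  have hd: "?h g dvd ?h f" if "g dvd f" for f
    using that by (metis dvd_def map_poly_of_rat_mult)
  have deg: "degree (?h g) = degree g"
    by (rule degree_map_poly) auto
  have "degree g = 0"
  proof (rule ccontr)
    assume "degree g \<noteq> 0"
    then have "\<not> constant (poly (?h g))"
      using deg by (simp add: constant_degree)
    then obtain z where "poly (?h g) z = 0"
      using fundamental_theorem_of_algebra by blast
    then have "poly (?h p) z = 0" "poly (cyclotomic_complex n) z = 0"
      using hd[OF g(1)] hd[OF g(2)] by (auto simp: map_poly_cyclotomic dvd_def)
    then show False
      using assms cyclotomic_complex_root by blast
  qed
  moreover have "g \<noteq> 0"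
    using g cyclotomic_nonzero by auto
  ultimately show "is_unit g"
    by (simp add: is_unit_iff_degree)
qed

lemma cyclotomic_dvd:
  assumes "n > 0"
  shows "cyclotomic n dvd 1 - monom 1 n"
proof -
  let ?h = "map_poly of_rat :: rat poly \<Rightarrow> complex poly"
  have "cyclotomic_complex n dvd (monom 1 n - 1 :: complex poly)"
    using assms unfolding prod_cyclotomic_complex[OF assms, symmetric] by (intro dvd_prodI) auto
  moreover have "?h (monom 1 n - 1) = monom 1 n - 1"
    by (intro poly_eqI) (simp add: coeff_map_poly of_rat_diff)
  ultimately obtain C where "?h (monom 1 n - 1) = ?h (cyclotomic n) * C"
    by (metis dvd_def map_poly_cyclotomic)
  then have "?h (monom 1 n - 1) = ?h (cyclotomic n * ((monom 1 n - 1) div cyclotomic n))"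
    using map_poly_of_rat_cofactor[of "monom 1 n - 1" "cyclotomic n" C] cyclotomic_nonzero
    by (simp add: map_poly_of_rat_mult)
  then have "monom 1 n - 1 = cyclotomic n * ((monom 1 n - 1) div cyclotomic n)"
    by (simp add: map_poly_of_rat_inject)
  then have "cyclotomic n dvd monom 1 n - 1"
    by (metis dvd_triv_left)
  then show ?thesis
    by (simp add: dvd_diff_commute)
qed

section \<open>Units modulo a cyclotomic polynomial\<close>

lemma qvar_power: "qvar ^ m = Fract (monom 1 m) 1"
  by (induction m) (auto simp: qvar_def One_fract_def monom_Suc)

lemma one_minus_qvar_power_n: "n > 0 \<Longrightarrow> 1 - qvar ^ n \<in> power_ideal (cyclotomic n) 1"
proof -
  assume "n > 0"
  then obtain C where "1 - monom 1 n = cyclotomic n * C"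
    using cyclotomic_dvd by (auto elim: dvdE)
  then have "1 - qvar ^ n = Fract (cyclotomic n) 1 ^ 1 * Fract C 1"
    by (simp add: qvar_power One_fract_def)
  then show ?thesis
    using localized_poly unfolding power_ideal_def mem_Collect_eq by blast
qed

lemma qvar_localized: "qvar \<in> localized P"
  by (simp add: qvar_def localized_poly)

lemma qvar_unit:
  assumes "n > 0"
  shows "qvar \<in> local_units (cyclotomic n)"
  unfolding qvar_def
proof (intro local_unit_poly coprime_cyclotomicI)
  fix z :: complex assume "\<And>m. z ^ m = 1 \<longleftrightarrow> n dvd m"
  then have "z ^ n = 1" by simp
  then show "poly (map_poly of_rat [:0, 1:]) z \<noteq> 0"
    using assms by (auto simp: map_poly_pCons power_0_left)
qed (use assms in auto)

text \<open>
  The common form of the elements that have to be recognised as units.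
\<close>

lemma linear_in_power_unit:
  fixes a b :: nat
  assumes "n > 0" "\<And>z::complex. (\<And>m. z ^ m = 1 \<longleftrightarrow> n dvd m) \<Longrightarrow> of_nat a \<noteq> of_nat b * z ^ m"
  shows "of_nat a - of_nat b * qvar ^ m \<in> local_units (cyclotomic n)"
proof -
  have eq: "of_nat a - of_nat b * qvar ^ m = Fract (of_nat a - of_nat b * monom 1 m) 1"
    by (simp add: qvar_power Fract_of_nat_eq[symmetric])
  have h: "map_poly of_rat (of_nat a - of_nat b * monom 1 m) = (of_nat a - of_nat b * monom 1 m :: complex poly)"
    by (intro poly_eqI) (simp add: coeff_map_poly of_rat_diff of_nat_poly coeff_pCons of_rat_mult split: nat.split)
  have *: "coprime (of_nat a - of_nat b * monom 1 m) (cyclotomic n)"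
    using assms by (intro coprime_cyclotomicI) (auto simp: h poly_monom)
  have "of_nat a - of_nat b * monom 1 m \<noteq> (0 :: rat poly)"
  proof
    assume z: "of_nat a - of_nat b * monom 1 m = (0 :: rat poly)"
    (* A zero polynomial would vanish at the root w of the cyclotomic polynomial. *)
    define w where "w = cis (2 * pi / n)"
    have "poly (cyclotomic_complex n) w = 0"
    proof -
      have "(1 \<le> (1::nat) \<and> 1 \<le> n \<and> coprime n 1)" using assms(1) by simp
      then show ?thesis
        unfolding cyclotomic_complex_def poly_prod w_def using assms(1)
        by (intro prod_zero bexI[of _ 1]) auto
    qed
    then have "of_nat a \<noteq> of_nat b * w ^ m"
      using assms cyclotomic_complex_root by blast
    moreover have "poly (map_poly of_rat (of_nat a - of_nat b * monom 1 m)) w = 0"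
      by (simp only: z) simp
    ultimately show False
      by (simp add: h poly_monom)
  qed
  then show ?thesis
    unfolding eq using * by (intro local_unit_poly)
qed

lemma one_minus_qvar_power_unit:
  assumes "n > 0" "\<not> n dvd m"
  shows "1 - qvar ^ m \<in> local_units (cyclotomic n)"
  using linear_in_power_unit[of n 1 1 m] assms by (metis mult_1 of_nat_1)

lemma norm_root_of_unity:
  fixes z :: complex
  assumes "n > 0" "z ^ n = 1"
  shows "norm (z ^ m) = 1"
proof -
  have "norm z ^ n = 1"
    using assms(2) by (simp flip: norm_power)
  then have "norm z = 1"
    using power_eq_imp_eq_base[of "norm z" n 1] assms(1) by simp
  then show ?thesis by (simp add: norm_power)
qed

text \<open>
  Roots of unity have absolute value 1, hence \<open>b z\<^sup>m\<close> cannot equal \<open>a\<close> when \<open>a\<close> and \<open>b\<close> are different natural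
  numbers. This is why natural numbers \<open>a \<ge> 2\<close> serve as generic values of the parameter: no factor
  \<open>1 - a q\<^sup>m\<close> or \<open>1 - q\<^sup>m / a\<close> has a common zero with the cyclotomic polynomial.
\<close>

lemma nat_minus_nat_power_unit:
  assumes "n > 0" "a \<noteq> b"
  shows "of_nat a - of_nat b * qvar ^ m \<in> local_units (cyclotomic n)"
proof (rule linear_in_power_unit)
  fix z :: complex assume "\<And>m. z ^ m = 1 \<longleftrightarrow> n dvd m"
  then have "norm (z ^ m) = 1"
    using norm_root_of_unity[of n z m] assms by simp
  then have "norm (of_nat a :: complex) \<noteq> norm (of_nat b * z ^ m)"
    using assms(2) by (simp add: norm_mult)
  then show "of_nat a \<noteq> of_nat b * z ^ m" by metis
qed (use assms in auto)

lemma qvar_power_neq_1: "m > 0 \<Longrightarrow> qvar ^ m \<noteq> 1"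
proof
  assume "m > 0" "qvar ^ m = 1"
  then have "monom 1 m = (1 :: rat poly)"
    by (simp add: qvar_power One_fract_def eq_fract)
  then have "degree (monom 1 m :: rat poly) = 0"
    by simp
  with \<open>m > 0\<close> show False
    by (simp add: degree_monom_eq)
qed

lemma qvar_powers_unit:
  assumes "n > 0" "a \<noteq> b"
  shows "of_nat a * qvar ^ s - of_nat b * qvar ^ t \<in> local_units (cyclotomic n)"
proof -
  note q = local_unit_power[OF qvar_unit[OF assms(1)]]
  show ?thesis
  proof (cases "s \<le> t")
    case True
    then have "of_nat a * qvar ^ s - of_nat b * qvar ^ t = qvar ^ s * (of_nat a - of_nat b * qvar ^ (t - s))"
      by (simp add: algebra_simps flip: power_add)
    then show ?thesis
      using q nat_minus_nat_power_unit[OF assms] by (simp add: local_unit_mult)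
  next
    case False
    then have "of_nat a * qvar ^ s - of_nat b * qvar ^ t = - (qvar ^ t * (of_nat b - of_nat a * qvar ^ (s - t)))"
      by (simp add: algebra_simps flip: power_add)
    then show ?thesis
      using q nat_minus_nat_power_unit[OF assms(1)] assms(2) by (simp add: local_unit_mult local_unit_uminus)
  qed
qed

lemma of_nat_unit: "n > 0 \<Longrightarrow> a > 0 \<Longrightarrow> of_nat a \<in> local_units (cyclotomic n)"
  using nat_minus_nat_power_unit[of n a 0 0] by simp

lemma quad_factor_unit:
  assumes "n > 0" "a \<ge> 2"
  shows "quad_factor ((of_nat a - 1) ^ 2 / of_nat a) (qvar ^ s) \<in> local_units (cyclotomic n)"
proof -
  have A: "of_nat a \<in> local_units (cyclotomic n)"
    using assms by (intro of_nat_unit) auto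
  have "1 - of_nat a * qvar ^ s \<in> local_units (cyclotomic n)"
    using nat_minus_nat_power_unit[of n 1 a s] assms by simp
  moreover have "1 - qvar ^ s / of_nat a = (of_nat a - qvar ^ s) / of_nat a"
    using local_unit_nonzero[OF A] by (simp add: field_simps)
  moreover have "of_nat a - qvar ^ s \<in> local_units (cyclotomic n)"
    using nat_minus_nat_power_unit[of n a 1 s] assms by simp
  ultimately show ?thesis
    using A local_unit_nonzero[OF A] by (simp add: quad_factor_split local_unit_mult local_unit_divide)
qed

lemma odd_not_dvd_even:
  fixes n k :: nat
  assumes "odd n" "even k" "0 < k" "k < 2 * n"
  shows "\<not> n dvd k"
proof
  assume "n dvd k"
  then obtain c where "k = n * c" by auto
  with assms show False
    by (cases c; cases "c - 1") auto
qed

lemma qpoch_four_unit: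
  assumes "odd n" "n = 2 * m + 1" "k \<le> m"
  shows "qpoch (qvar ^ 4) (qvar ^ 4) k \<in> local_units (cyclotomic n)"
  unfolding qpoch_def
proof (intro local_unit_prod)
  fix j assume j: "j \<in> {..<k}"
  have "qvar ^ 4 * (qvar ^ 4) ^ j = qvar ^ (4 * j + 4)"
    by (simp add: add.commute flip: power_add power_mult)
  moreover have "\<not> n dvd 4 * j + 4"
    using odd_not_dvd_even[of n "4 * j + 4"] assms j by simp
  ultimately show "1 - qvar ^ 4 * (qvar ^ 4) ^ j \<in> local_units (cyclotomic n)"
    using assms one_minus_qvar_power_unit[of n] by simp
qed

section \<open>Divisibility of the parametric sum\<close>

lemma prod_split_lessThan:
  fixes f :: "nat \<Rightarrow> 'a::comm_monoid_mult"
  assumes "k \<le> m"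
  shows "(\<Prod>j<m. f j) = (\<Prod>j<k. f j) * (\<Prod>j=k..<m. f j)"
  using assms by (simp add: lessThan_atLeast0 prod.atLeastLessThan_concat)

lemma degree_prod_linear_le:
  fixes p :: "nat \<Rightarrow> 'a::comm_semiring_1 poly"
  assumes "\<And>j. degree (p j) \<le> 1" "finite A"
  shows "degree (\<Prod>j\<in>A. p j) \<le> card A"
proof -
  have "degree (\<Prod>j\<in>A. p j) \<le> (\<Sum>j\<in>A. degree (p j))"
    using degree_prod_sum_le[OF assms(2), of p] by (simp add: o_def)
  also have "\<dots> \<le> card A"
    using sum_bounded_above[of A "\<lambda>j. degree (p j)" 1] assms(1) by simp
  finally show ?thesis .
qed

lemma degree_split_prod_le:
  fixes f g :: "nat \<Rightarrow> 'a::comm_semiring_1 poly"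
  assumes "\<And>j. degree (f j) \<le> 1" "\<And>j. degree (g j) \<le> 1" "k \<le> m"
  shows "degree (smult c ((\<Prod>j<k. f j) * (\<Prod>j=k..<m. g j))) \<le> m"
proof -
  have "degree ((\<Prod>j<k. f j) * (\<Prod>j=k..<m. g j)) \<le> degree (\<Prod>j<k. f j) + degree (\<Prod>j=k..<m. g j)"
    by (rule degree_mult_le)
  also have "\<dots> \<le> k + (m - k)"
    using degree_prod_linear_le[of f "{..<k}"] degree_prod_linear_le[of g "{k..<m}"] assms
    by (intro add_mono) auto
  finally show ?thesis
    using assms(3) degree_smult_le[of c "(\<Prod>j<k. f j) * (\<Prod>j=k..<m. g j)"] by linarith
qed

text \<open>
  The last factor of \<open>(q; q\<^sup>2)\<^bsub>m+1\<^esub>\<close> is \<open>1 - q\<^bsup>2m+1\<^esup> = 1 - q\<^sup>n\<close>, which is divisible by the cyclotomic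
  polynomial.
\<close>

lemma wz_boundary_divisible:
  assumes "odd n" "n = 2 * m + 1"
    and x: "x \<in> localized (cyclotomic n)" "\<And>j. quad_factor x (qvar ^ (4 * j + 4)) \<in> local_units (cyclotomic n)"
    and e: "e \<in> localized (cyclotomic n)" "\<And>j. 1 - e * qvar ^ j \<in> local_units (cyclotomic n)"
  shows "wz_boundary qvar x e m \<in> power_ideal (cyclotomic n) 1"
proof -
  let ?P = "cyclotomic n"
  have "qpoch qvar (qvar ^ 2) (Suc m) = (1 - qvar ^ n) * qpoch qvar (qvar ^ 2) m"
    by (simp add: qpoch_def assms(2) mult.commute flip: power_mult)
  then have "wz_boundary qvar x e m = (1 - qvar ^ n) *
     (e * qpoch qvar (qvar ^ 2) m / qpoch (qvar ^ 4) (qvar ^ 4) m * qvar ^ ((m + 1) ^ 2 + 2 * (m + 1))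
     * ((\<Prod>i<Suc m. quad_factor x (qvar ^ (2 * i + 1))) / (\<Prod>i<m. quad_factor x (qvar ^ (4 * i + 4))))
     * ((\<Prod>i<m. e - qvar ^ (4 * i)) / (\<Prod>i<m. 1 - e * qvar ^ (2 * i + 7))))"
    unfolding wz_boundary_def by (simp only: divide_inverse mult_ac)
  also have "\<dots> \<in> power_ideal ?P 1"
  proof (rule power_ideal_mult_right)
    show "1 - qvar ^ n \<in> power_ideal ?P 1"
      using assms by (intro one_minus_qvar_power_n) auto
    show "e * qpoch qvar (qvar ^ 2) m / qpoch (qvar ^ 4) (qvar ^ 4) m * qvar ^ ((m + 1) ^ 2 + 2 * (m + 1))
     * ((\<Prod>i<Suc m. quad_factor x (qvar ^ (2 * i + 1))) / (\<Prod>i<m. quad_factor x (qvar ^ (4 * i + 4))))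
     * ((\<Prod>i<m. e - qvar ^ (4 * i)) / (\<Prod>i<m. 1 - e * qvar ^ (2 * i + 7))) \<in> localized ?P"
      unfolding qpoch_def[of qvar] quad_factor_def[of x "qvar ^ (2 * _ + 1)"]
      using qpoch_four_unit[OF assms(1,2) order_refl] x e
      by (intro localized_mult localized_divide localized_prod localized_diff localized_power local_unit_prod
          qvar_localized localized_1)
  qed
  finally show ?thesis .
qed

text \<open>
  The points \<open>e = 1 / (a q\<^bsup>4(i+1)\<^esup>)\<close> form a chain under \<open>e \<mapsto> e q\<^sup>4\<close> that ends at \<open>1 / a\<close>, a zero of
  \<open>quad_factor\<close> for the parameter \<open>a\<close>.
\<close>

definition sum_point :: "nat \<Rightarrow> nat \<Rightarrow> ratfun" where
  "sum_point a i = 1 / (of_nat a * qvar ^ (4 * (i + 1)))"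

lemma sum_point_shift: "sum_point a (Suc i) * qvar ^ 4 = sum_point a i"
proof -
  have "qvar ^ (4 * (Suc i + 1)) = qvar ^ (4 * (i + 1)) * qvar ^ 4"
    by (simp add: add.commute flip: power_add)
  then show ?thesis
    unfolding sum_point_def using local_unit_nonzero[OF qvar_unit[of 1]] by simp
qed

lemma sum_point_localized:
  assumes "n > 0" "a > 0"
  shows "sum_point a i \<in> localized (cyclotomic n)"
  unfolding sum_point_def
  by (intro localized_divide localized_1 local_unit_mult local_unit_power qvar_unit of_nat_unit assms)

lemma one_minus_sum_point_unit:
  assumes "n > 0" "a \<ge> 2"
  shows "1 - sum_point a i * qvar ^ s \<in> local_units (cyclotomic n)"
proof -
  have den: "of_nat a * qvar ^ (4 * (i + 1)) \<in> local_units (cyclotomic n)"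
    using assms by (intro local_unit_mult local_unit_power qvar_unit of_nat_unit) auto
  have "1 - sum_point a i * qvar ^ s
        = (of_nat a * qvar ^ (4 * (i + 1)) - of_nat 1 * qvar ^ s) / (of_nat a * qvar ^ (4 * (i + 1)))"
    unfolding sum_point_def diff_divide_distrib using local_unit_nonzero[OF den] by simp
  moreover have "of_nat a * qvar ^ (4 * (i + 1)) - of_nat 1 * qvar ^ s \<in> local_units (cyclotomic n)"
    using assms by (intro qvar_powers_unit) auto
  ultimately show ?thesis
    using den by (simp only: local_unit_divide)
qed

text \<open>
  Modulo the cyclotomic polynomial the boundary term disappears, and the recurrence becomes
  \<open>L(e q\<^sup>4) S(e q\<^sup>4) \<equiv> (1 - e q\<^sup>3) (1 - e q\<^sup>5) S(e)\<close> with \<open>L\<close> the quadratic factor. At the first point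
  \<open>L(e q\<^sup>4) = 0\<close>, so \<open>S(e) \<equiv> 0\<close>, and this propagates along the chain since the factors on the right are
  units.
\<close>

lemma sum_vanishes_at_sum_point:
  assumes n: "odd n" "n = 2 * m + 1" and a: "a \<ge> 2"
  defines "x \<equiv> (of_nat a - 1) ^ 2 / of_nat a"
  shows "(\<Sum>k\<le>m. quad_term qvar x (sum_point a i) k) \<in> power_ideal (cyclotomic n) 1"
proof -
  let ?P = "cyclotomic n"
  let ?S = "\<lambda>e. \<Sum>k\<le>m. quad_term qvar x e k"
  have n0: "n > 0" using n by simp
  have A: "of_nat a \<in> local_units ?P" and A0: "(of_nat a :: ratfun) \<noteq> 0"
    using of_nat_unit[OF n0, of a] a local_unit_nonzero by auto
  have x: "x \<in> localized ?P"
    unfolding x_def using A by (intro localized_divide localized_power localized_diff localized_1 localized_of_nat)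
  have L: "quad_factor x (qvar ^ s) \<in> local_units ?P" for s
    unfolding x_def by (rule quad_factor_unit[OF n0 a])
  have e: "sum_point a i \<in> localized ?P" for i
    using a by (intro sum_point_localized n0) auto
  have u: "1 - sum_point a i * qvar ^ s \<in> local_units ?P" for i s
    by (intro one_minus_sum_point_unit n0 a)
  have rec: "?S (sum_point a i) \<in> power_ideal ?P 1"
    if "quad_factor x (sum_point a i * qvar ^ 4) * ?S (sum_point a i * qvar ^ 4) \<in> power_ideal ?P 1" for i
  proof -
    let ?e = "sum_point a i"
    have nz: "quad_factor x (qvar ^ (4 * j + 4)) \<noteq> 0" "?e * qvar ^ (2 * j + 3) \<noteq> 1" for j
      using local_unit_nonzero[OF L] local_unit_nonzero[OF u[of i "2 * j + 3"]] by auto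
    have "quad_factor x (?e * qvar ^ 4) * ?S (?e * qvar ^ 4) - (1 - ?e * qvar ^ 3) * (1 - ?e * qvar ^ 5) * ?S ?e
          = wz_boundary qvar x ?e m"
      using wz_telescoping[of qvar x ?e m] nz qvar_power_neq_1
      by (simp add: sum_subtractf sum_distrib_left)
    moreover have solve: "s = (l - w) / d" if "l - d * s = w" "d \<noteq> 0" for s l w d :: ratfun
      using that by (simp add: eq_divide_eq algebra_simps)
    ultimately have "?S ?e = (quad_factor x (?e * qvar ^ 4) * ?S (?e * qvar ^ 4) - wz_boundary qvar x ?e m)
                        / ((1 - ?e * qvar ^ 3) * (1 - ?e * qvar ^ 5))"
      using local_unit_nonzero[OF local_unit_mult[OF u u]] solve by blast
    also have "\<dots> \<in> power_ideal ?P 1"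
      using that x L e u by (intro power_ideal_divide power_ideal_diff wz_boundary_divisible n local_unit_mult)
    finally show ?thesis .
  qed
  show ?thesis
  proof (induction i)
    case 0
    have "sum_point a 0 * qvar ^ 4 = 1 / of_nat a"
      unfolding sum_point_def using local_unit_nonzero[OF qvar_unit[OF n0]] by simp
    then have "quad_factor x (sum_point a 0 * qvar ^ 4) = 0"
      unfolding x_def using A0 by (simp add: quad_factor_split)
    then show ?case
      by (intro rec) (simp add: zero_in_power_ideal)
  next
    case (Suc i)
    have "quad_factor x (sum_point a i) \<in> localized ?P"
      unfolding quad_factor_def using x e
      by (intro localized_diff localized_mult localized_power localized_1)
    then show ?case
      using Suc by (intro rec) (auto simp: sum_point_shift intro: power_ideal_mult_left)
  qed
qed

text \<open>
  Multiplication by \<open>(1 - e q\<^sup>3) (1 - e q\<^sup>5) \<dots> (1 - e q\<^bsup>2m+1\<^esup>)\<close> turns the sum into a polynomial in \<open>e\<close>,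
  to which interpolation applies.
\<close>

definition sum_poly :: "ratfun \<Rightarrow> nat \<Rightarrow> ratfun poly" where
  "sum_poly x m = (\<Sum>k\<le>m. smult (base_coeff qvar k
     * ((\<Prod>j<k. quad_factor x (qvar ^ (2 * j + 1))) / (\<Prod>j<k. quad_factor x (qvar ^ (4 * j + 4)))))
     ((\<Prod>j<k. [:- (qvar ^ (4 * j)), 1:]) * (\<Prod>j=k..<m. [:1, - (qvar ^ (2 * j + 3)):])))"

lemma degree_sum_poly: "degree (sum_poly x m) \<le> m"
  unfolding sum_poly_def by (intro degree_sum_le degree_split_prod_le) auto

lemma poly_sum_poly:
  assumes "\<And>j. j < m \<Longrightarrow> 1 - e * qvar ^ (2 * j + 3) \<noteq> 0"
  shows "poly (sum_poly x m) e = (\<Prod>j<m. 1 - e * qvar ^ (2 * j + 3)) * (\<Sum>k\<le>m. quad_term qvar x e k)"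
proof -
  have "poly (sum_poly x m) e = (\<Sum>k\<le>m. base_coeff qvar k
     * ((\<Prod>j<k. quad_factor x (qvar ^ (2 * j + 1))) / (\<Prod>j<k. quad_factor x (qvar ^ (4 * j + 4))))
     * ((\<Prod>j<k. e - qvar ^ (4 * j)) * (\<Prod>j=k..<m. 1 - e * qvar ^ (2 * j + 3))))"
    by (simp add: sum_poly_def poly_sum poly_prod)
  also have "\<dots> = (\<Sum>k\<le>m. (\<Prod>j<m. 1 - e * qvar ^ (2 * j + 3)) * quad_term qvar x e k)"
  proof (intro sum.cong refl)
    fix k assume k: "k \<in> {..m}"
    then have "(\<Prod>j<k. 1 - e * qvar ^ (2 * j + 3)) \<noteq> 0"
      using assms by simp
    then have "(\<Prod>j<k. e - qvar ^ (4 * j)) * (\<Prod>j=k..<m. 1 - e * qvar ^ (2 * j + 3))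
       = (\<Prod>j<m. 1 - e * qvar ^ (2 * j + 3)) * ((\<Prod>j<k. e - qvar ^ (4 * j)) / (\<Prod>j<k. 1 - e * qvar ^ (2 * j + 3)))"
      using k by (subst prod_split_lessThan[of k m]) auto
    then show "base_coeff qvar k
     * ((\<Prod>j<k. quad_factor x (qvar ^ (2 * j + 1))) / (\<Prod>j<k. quad_factor x (qvar ^ (4 * j + 4))))
     * ((\<Prod>j<k. e - qvar ^ (4 * j)) * (\<Prod>j=k..<m. 1 - e * qvar ^ (2 * j + 3)))
     = (\<Prod>j<m. 1 - e * qvar ^ (2 * j + 3)) * quad_term qvar x e k"
      unfolding quad_term_def by (simp only: mult_ac)
  qed
  finally show ?thesis
    by (simp add: sum_distrib_left)
qed

text \<open>
  The degree is at most \<open>m\<close>, so the vanishing at \<open>m + 1\<close> of the points forces all coefficients into the ideal.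
  Hence the sum is divisible by the cyclotomic polynomial identically in \<open>e\<close>.
\<close>

lemma sum_poly_coeffs:
  assumes n: "odd n" "n = 2 * m + 1" and a: "a \<ge> 2"
  defines "x \<equiv> (of_nat a - 1) ^ 2 / of_nat a"
  shows "coeff (sum_poly x m) i \<in> power_ideal (cyclotomic n) 1"
proof (rule coeffs_in_power_ideal[where N = "Suc m" and y = "sum_point a"])
  let ?P = "cyclotomic n"
  have n0: "n > 0" using n by simp
  have A: "of_nat a \<in> local_units ?P"
    using of_nat_unit[OF n0, of a] a by auto
  have den: "of_nat a * qvar ^ s \<in> local_units ?P" for s
    using A by (intro local_unit_mult local_unit_power qvar_unit n0)
  show e: "sum_point a i \<in> localized ?P" for i
    using a by (intro sum_point_localized n0) auto
  show "coeff (sum_poly x m) i = 0" if "i \<ge> Suc m" for i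
    using that degree_sum_poly[of x m] by (intro coeff_eq_0) simp
  show "poly (sum_poly x m) (sum_point a i) \<in> power_ideal ?P 1" for i
  proof -
    have "1 - sum_point a i * qvar ^ s \<noteq> 0" for s
      by (rule local_unit_nonzero[OF one_minus_sum_point_unit[OF n0 a]])
    then have "poly (sum_poly x m) (sum_point a i)
        = (\<Prod>j<m. 1 - sum_point a i * qvar ^ (2 * j + 3)) * (\<Sum>k\<le>m. quad_term qvar x (sum_point a i) k)"
      by (intro poly_sum_poly)
    also have "\<dots> \<in> power_ideal ?P 1"
      unfolding x_def using e
      by (intro power_ideal_mult_left sum_vanishes_at_sum_point n a localized_prod localized_diff localized_mult
          localized_power qvar_localized localized_1)
    finally show ?thesis .
  qed
  show "sum_point a i - sum_point a j \<in> local_units ?P" if ij: "i < Suc m" "j < Suc m" "i \<noteq> j" for i j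
  proof -
    have less: "sum_point a i - sum_point a j \<in> local_units ?P" if "i < j" "j < Suc m" for i j
    proof -
      have "4 * (j + 1) = 4 * (i + 1) + 4 * (j - i)"
        using that by simp
      then have "qvar ^ (4 * (j + 1)) = qvar ^ (4 * (i + 1)) * qvar ^ (4 * (j - i))"
        by (metis power_add)
      then have diff: "sum_point a i - sum_point a j = - (1 - qvar ^ (4 * (j - i))) / (of_nat a * qvar ^ (4 * (j + 1)))"
        unfolding sum_point_def using local_unit_nonzero[OF qvar_unit[OF n0]] local_unit_nonzero[OF A]
        by (simp add: field_simps)
      have ndvd: "\<not> n dvd 4 * (j - i)"
        using odd_not_dvd_even[of n "4 * (j - i)"] n that by simp
      show ?thesis
        unfolding diff by (intro local_unit_divide local_unit_uminus den one_minus_qvar_power_unit n0 ndvd)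
    qed
    show ?thesis
    proof (cases "i < j")
      case False
      then have "sum_point a j - sum_point a i \<in> local_units ?P"
        using ij by (intro less) auto
      then show ?thesis
        using local_unit_uminus by fastforce
    qed (use less ij in auto)
  qed
qed

text \<open>
  The part of the closed form of \<open>terminating_quadratic_sum\<close> that does not depend on \<open>x\<close>.
\<close>

definition closed_numerator :: "nat \<Rightarrow> ratfun" where
  "closed_numerator M = (1 - qvar) * (\<Prod>j<M. (1 - qvar ^ (4 * j + 3)) * (1 - qvar ^ (4 * j + 5)))"

text \<open>
  The arguments \<open>e = q\<close> and \<open>e = q\<^bsup>4M\<^esup> = q\<^bsup>n+1\<^esup>\<close> differ by a multiple of \<open>1 - q\<^sup>n\<close>. Since the sum is
  already divisible by the cyclotomic polynomial as a function of \<open>e\<close>, its values at these arguments agree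
  modulo the square, and the second one is known in closed form.
\<close>

lemma parametric_congruence:
  assumes n: "n + 1 = 4 * M" "n = 2 * m + 1" and a: "a \<ge> 2"
  defines "x \<equiv> (of_nat a - 1) ^ 2 / of_nat a"
  shows "(\<Sum>k\<le>m. quad_term qvar x qvar k) - closed_numerator M / (\<Prod>j<M. quad_factor x (qvar ^ (4 * j + 4)))
     \<in> power_ideal (cyclotomic n) 2"
proof -
  let ?P = "cyclotomic n"
  let ?W = "sum_poly x m"
  let ?S = "\<lambda>e. \<Sum>k\<le>m. quad_term qvar x e k"
  let ?D = "\<lambda>e. \<Prod>j<m. 1 - e * qvar ^ (2 * j + 3)"
  let ?q' = "qvar ^ (4 * M)"
  have n0: "n > 0" and odd: "odd n" and Mm: "M \<le> m" using n by presburger+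
  note W = sum_poly_coeffs[OF odd n(2) a, folded x_def]
  have div: "\<not> n dvd 2 * j + 4" if "j < m" for j
    using odd_not_dvd_even[of n "2 * j + 4"] odd n that by simp
  have u: "1 - qvar * qvar ^ (2 * j + 3) \<in> local_units ?P" "1 - ?q' * qvar ^ (2 * j + 3) \<in> local_units ?P" if "j < m" for j
  proof -
    have "qvar * qvar ^ (2 * j + 3) = qvar ^ (2 * j + 4)"
      by (simp add: numeral_eq_Suc)
    then show "1 - qvar * qvar ^ (2 * j + 3) \<in> local_units ?P"
      using one_minus_qvar_power_unit[OF n0 div[OF that]] by simp
    have "4 * M + (2 * j + 3) = n + (2 * j + 4)"
      using n(1) by simp
    then have "?q' * qvar ^ (2 * j + 3) = qvar ^ (n + (2 * j + 4))"
      by (metis power_add)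
    moreover have "\<not> n dvd n + (2 * j + 4)"
      unfolding dvd_add_triv_left_iff by (rule div[OF that])
    ultimately show "1 - ?q' * qvar ^ (2 * j + 3) \<in> local_units ?P"
      using one_minus_qvar_power_unit[OF n0] by simp
  qed
  have D: "?D qvar \<in> local_units ?P" "?D ?q' \<in> local_units ?P"
    using u by (auto intro!: local_unit_prod)
  have q: "qvar \<in> localized ?P" "?q' \<in> localized ?P"
    by (auto intro: qvar_localized localized_power)
  have "qvar - ?q' = qvar * (1 - qvar ^ n)"
    using n(1) by (simp add: right_diff_distrib flip: power_Suc)
  then have qq: "qvar - ?q' \<in> power_ideal ?P 1"
    using one_minus_qvar_power_n[OF n0] q by (simp add: power_ideal_mult_left)
  have WD: "poly ?W qvar = ?D qvar * ?S qvar" "poly ?W ?q' = ?D ?q' * ?S ?q'"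
    using local_unit_nonzero[OF u(1)] local_unit_nonzero[OF u(2)] by (auto intro!: poly_sum_poly)
  (* The denominators D at the two arguments agree only to first order; this suffices because the
     numerator W at the second argument is itself in the ideal. *)
  have "?D ?q' - ?D qvar \<in> power_ideal ?P 1"
  proof (rule prod_diff_in_power_ideal)
    fix j
    have "1 - ?q' * qvar ^ (2 * j + 3) - (1 - qvar * qvar ^ (2 * j + 3)) = (qvar - ?q') * qvar ^ (2 * j + 3)"
      by (simp add: algebra_simps)
    then show "1 - ?q' * qvar ^ (2 * j + 3) - (1 - qvar * qvar ^ (2 * j + 3)) \<in> power_ideal ?P 1"
      using qq by (simp only: power_ideal_mult_right localized_power qvar_localized)
  qed (intro localized_diff localized_mult localized_power qvar_localized localized_1)+
  then have "poly ?W ?q' * (?D ?q' - ?D qvar) \<in> power_ideal ?P (1 + 1)"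
    using W q by (intro power_ideal_mult poly_in_power_ideal)
  moreover have "poly ?W qvar - poly ?W ?q' \<in> power_ideal ?P (1 + 1)"
    using W q qq by (intro poly_diff_in_power_ideal)
  ultimately have "(poly ?W qvar - poly ?W ?q') / ?D qvar + poly ?W ?q' * (?D ?q' - ?D qvar) / (?D qvar * ?D ?q')
     \<in> power_ideal ?P (1 + 1)"
    using D by (intro power_ideal_add power_ideal_divide local_unit_mult)
  also have "(poly ?W qvar - poly ?W ?q') / ?D qvar + poly ?W ?q' * (?D ?q' - ?D qvar) / (?D qvar * ?D ?q')
     = ?S qvar - ?S ?q'"
  proof -
    have "(d * s - d' * s') / d + d' * s' * (d' - d) / (d * d') = s - s'" if "d \<noteq> 0" "d' \<noteq> 0" for d d' s s' :: ratfun
      using that by (simp add: field_simps)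
    then show ?thesis
      unfolding WD using local_unit_nonzero[OF D(1)] local_unit_nonzero[OF D(2)] by blast
  qed
  also have "?S ?q' = closed_numerator M / (\<Prod>j<M. quad_factor x (qvar ^ (4 * j + 4)))"
  proof -
    have "quad_factor x (qvar ^ (4 * j + 4)) \<noteq> 0" for j
      unfolding x_def by (rule local_unit_nonzero[OF quad_factor_unit[OF n0 a]])
    then show ?thesis
      using terminating_quadratic_sum[of qvar x M m] qvar_power_neq_1 Mm
      by (simp add: closed_numerator_def prod_dividef)
  qed
  finally show ?thesis
    by (simp add: numeral_2_eq_2)
qed

section \<open>The linear coefficient in the parameter\<close>

definition quad_factor_poly :: "ratfun \<Rightarrow> ratfun poly" where
  "quad_factor_poly y = [:(1 - y) ^ 2, - y:]"

lemma poly_quad_factor_poly: "poly (quad_factor_poly y) x = quad_factor x y"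
  by (simp add: quad_factor_poly_def quad_factor_def)

lemma coeff_0_prod_quad_factor_poly:
  "coeff (\<Prod>j\<in>A. quad_factor_poly (y j)) 0 = (\<Prod>j\<in>A. (1 - y j) ^ 2)"
  by (induction A rule: infinite_finite_induct) (simp_all add: quad_factor_poly_def coeff_mult)

text \<open>
  Logarithmic differentiation at \<open>x = 0\<close>; it produces the sums of \<open>y / (1 - y)\<^sup>2\<close> that occur in the theorem.
\<close>

lemma coeff_1_prod_quad_factor_poly:
  assumes "\<And>j. j \<in> A \<Longrightarrow> y j \<noteq> 1"
  shows "coeff (\<Prod>j\<in>A. quad_factor_poly (y j)) 1
         = - (\<Prod>j\<in>A. (1 - y j) ^ 2) * (\<Sum>j\<in>A. y j / (1 - y j) ^ 2)"
  using assms
proof (induction A rule: infinite_finite_induct)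
  case (insert i A)
  have i: "(1 - y i) ^ 2 \<noteq> 0"
    using insert.prems[of i] by simp
  let ?G = "\<Prod>j\<in>A. quad_factor_poly (y j)"
  have "coeff (\<Prod>j\<in>insert i A. quad_factor_poly (y j)) 1 = (1 - y i) ^ 2 * coeff ?G 1 - y i * coeff ?G 0"
    using insert.hyps by (simp add: quad_factor_poly_def coeff_pCons)
  also have "\<dots> = - ((1 - y i) ^ 2 * (\<Prod>j\<in>A. (1 - y j) ^ 2)) * (y i / (1 - y i) ^ 2 + (\<Sum>j\<in>A. y j / (1 - y j) ^ 2))"
    using insert i by (simp add: coeff_0_prod_quad_factor_poly distrib_left)
  finally show ?case
    using insert.hyps by simp
qed (simp_all)

definition x_free_term :: "nat \<Rightarrow> ratfun" where
  "x_free_term k = base_coeff qvar k * ((\<Prod>j<k. qvar - qvar ^ (4 * j)) / (\<Prod>j<k. 1 - qvar * qvar ^ (2 * j + 3)))"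

definition mixed_poly :: "nat \<Rightarrow> nat \<Rightarrow> ratfun poly" where
  "mixed_poly m k = (\<Prod>j<k. quad_factor_poly (qvar ^ (2 * j + 1))) * (\<Prod>j=k..<m. quad_factor_poly (qvar ^ (4 * j + 4)))"

text \<open>
  The difference of the two sides of \<open>parametric_congruence\<close> times the common denominator
  \<open>\<Prod>\<^bsub>j<m\<^esub> quad_factor x (q\<^bsup>4j+4\<^esup>)\<close>, as a polynomial in \<open>x\<close>.
\<close>

definition difference_poly :: "nat \<Rightarrow> nat \<Rightarrow> ratfun poly" where
  "difference_poly M m = (\<Sum>k\<le>m. smult (x_free_term k) (mixed_poly m k))
     - smult (closed_numerator M) (\<Prod>j=M..<m. quad_factor_poly (qvar ^ (4 * j + 4)))"

lemma degree_difference_poly: "degree (difference_poly M m) \<le> m"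
  unfolding difference_poly_def
proof (intro degree_diff_le degree_sum_le)
  fix k assume "k \<in> {..m}"
  then show "degree (smult (x_free_term k) (mixed_poly m k)) \<le> m"
    unfolding mixed_poly_def by (intro degree_split_prod_le) (auto simp: quad_factor_poly_def)
next
  have "degree (\<Prod>j=M..<m. quad_factor_poly (qvar ^ (4 * j + 4))) \<le> card {M..<m}"
    by (intro degree_prod_linear_le) (auto simp: quad_factor_poly_def)
  then show "degree (smult (closed_numerator M) (\<Prod>j=M..<m. quad_factor_poly (qvar ^ (4 * j + 4)))) \<le> m"
    using degree_smult_le[of "closed_numerator M" "\<Prod>j=M..<m. quad_factor_poly (qvar ^ (4 * j + 4))"]
    unfolding card_atLeastLessThan by linarith
qed simp

lemma poly_difference_poly:
  assumes "\<And>j. quad_factor x (qvar ^ (4 * j + 4)) \<noteq> 0" "M \<le> m"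
  shows "poly (difference_poly M m) x = (\<Prod>j<m. quad_factor x (qvar ^ (4 * j + 4)))
    * ((\<Sum>k\<le>m. quad_term qvar x qvar k) - closed_numerator M / (\<Prod>j<M. quad_factor x (qvar ^ (4 * j + 4))))"
proof -
  let ?E = "\<lambda>k. \<Prod>j<k. quad_factor x (qvar ^ (4 * j + 4))"
  have split: "(\<Prod>j=k..<m. quad_factor x (qvar ^ (4 * j + 4))) = ?E m / ?E k" if "k \<le> m" for k
    using prod_split_lessThan[OF that, of "\<lambda>j. quad_factor x (qvar ^ (4 * j + 4))"] assms(1)
    by simp
  have "poly (smult (x_free_term k) (mixed_poly m k)) x = ?E m * quad_term qvar x qvar k" if "k \<le> m" for k
    unfolding mixed_poly_def poly_smult poly_mult poly_prod poly_quad_factor_poly split[OF that]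
      x_free_term_def quad_term_def
    by (simp only: divide_inverse mult_ac)
  moreover have "poly (smult (closed_numerator M) (\<Prod>j=M..<m. quad_factor_poly (qvar ^ (4 * j + 4)))) x
      = ?E m * (closed_numerator M / ?E M)"
    unfolding poly_smult poly_prod poly_quad_factor_poly split[OF assms(2)] by (simp only: divide_inverse mult_ac)
  ultimately show ?thesis
    by (simp add: difference_poly_def poly_sum right_diff_distrib sum_distrib_left)
qed

text \<open>
  The congruence holds for all parameters \<open>x = (a - 1)\<^sup>2 / a\<close> with \<open>a = 2, 3, \<dots>\<close>. The differences of these
  values are nonzero rational numbers, hence units, and interpolation gives the congruence for every coefficient.
\<close>

lemma coeffs_difference_poly:
  assumes n: "n + 1 = 4 * M" "n = 2 * m + 1"
  shows "coeff (difference_poly M m) i \<in> power_ideal (cyclotomic n) 2"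
proof (rule coeffs_in_power_ideal[where N = "Suc m" and y = "\<lambda>i. (of_nat (i + 2) - 1) ^ 2 / of_nat (i + 2)"])
  let ?P = "cyclotomic n"
  have n0: "n > 0" and Mm: "M \<le> m" using n by presburger+
  have A: "of_nat (i + 2) \<in> local_units ?P" for i
    by (intro of_nat_unit n0) auto
  show "coeff (difference_poly M m) i = 0" if "i \<ge> Suc m" for i
    using that degree_difference_poly[of M m] by (intro coeff_eq_0) simp
  show "(of_nat (i + 2) - 1) ^ 2 / of_nat (i + 2) \<in> localized ?P" for i
    using A by (intro localized_divide localized_power localized_diff localized_1 localized_of_nat)
  show "poly (difference_poly M m) ((of_nat (i + 2) - 1) ^ 2 / of_nat (i + 2)) \<in> power_ideal ?P 2" for i
  proof -
    have L: "quad_factor ((of_nat (i + 2) - 1) ^ 2 / of_nat (i + 2)) (qvar ^ s) \<in> local_units ?P" for s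
      by (intro quad_factor_unit n0) auto
    show ?thesis
      unfolding poly_difference_poly[OF local_unit_nonzero[OF L] Mm]
      by (intro power_ideal_mult_left localized_prod local_unit_localized L parametric_congruence n) auto
  qed
  show "(of_nat (i + 2) - 1) ^ 2 / of_nat (i + 2) - (of_nat (j + 2) - 1) ^ 2 / of_nat (j + 2) \<in> local_units ?P"
    if ij: "i \<noteq> j" for i j
  proof -
    define a b where "a = i + 2" and "b = j + 2"
    have ab: "a \<noteq> b" "a * b \<noteq> 1"
      using ij by (auto simp: a_def b_def)
    have u: "of_nat a \<in> local_units ?P" "of_nat b \<in> local_units ?P"
      unfolding a_def b_def by (rule A)+
    have "(of_nat a - 1) ^ 2 / of_nat a - (of_nat b - 1) ^ 2 / of_nat b
        = (of_nat a - of_nat b) * (of_nat (a * b) - of_nat 1) / (of_nat a * of_nat b :: ratfun)"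
      using local_unit_nonzero[OF u(1)] local_unit_nonzero[OF u(2)] by (simp add: field_simps power2_eq_square)
    moreover have "of_nat a - of_nat b \<in> local_units ?P" "of_nat (a * b) - of_nat 1 \<in> local_units ?P"
      using nat_minus_nat_power_unit[OF n0 ab(1), of 0] nat_minus_nat_power_unit[OF n0 ab(2), of 0]
      by simp_all
    ultimately have "(of_nat a - 1) ^ 2 / of_nat a - (of_nat b - 1) ^ 2 / of_nat b \<in> local_units ?P"
      using u by (simp only: local_unit_divide local_unit_mult)
    then show ?thesis
      by (simp only: a_def b_def)
  qed
qed

definition harmonic4 :: "nat \<Rightarrow> ratfun" where
  "harmonic4 k = (\<Sum>j<k. qvar ^ (4 * j + 4) / (1 - qvar ^ (4 * j + 4)) ^ 2)"

definition harmonic_odd :: "nat \<Rightarrow> ratfun" where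
  "harmonic_odd k = (\<Sum>j<k. qvar ^ (2 * j + 1) / (1 - qvar ^ (2 * j + 1)) ^ 2)"

definition square4 :: "nat \<Rightarrow> ratfun" where
  "square4 k = (\<Prod>j<k. (1 - qvar ^ (4 * j + 4)) ^ 2)"

definition square_odd :: "nat \<Rightarrow> ratfun" where
  "square_odd k = (\<Prod>j<k. (1 - qvar ^ (2 * j + 1)) ^ 2)"

lemma square4_nonzero: "square4 k \<noteq> 0"
  using qvar_power_neq_1 by (simp add: square4_def eq_commute[of 1])

lemma coeffs_tail_poly:
  assumes "k \<le> m"
  defines "G \<equiv> \<Prod>j=k..<m. quad_factor_poly (qvar ^ (4 * j + 4))"
  shows "coeff G 0 = square4 m / square4 k"
    and "coeff G 1 = - (square4 m / square4 k) * (harmonic4 m - harmonic4 k)"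
proof -
  have sq: "(\<Prod>j=k..<m. (1 - qvar ^ (4 * j + 4)) ^ 2) = square4 m / square4 k"
    using prod_split_lessThan[OF assms(1), of "\<lambda>j. (1 - qvar ^ (4 * j + 4)) ^ 2"] square4_nonzero[of k]
    unfolding square4_def by (metis nonzero_mult_div_cancel_left)
  show "coeff G 0 = square4 m / square4 k"
    unfolding G_def coeff_0_prod_quad_factor_poly sq ..
  have "(\<Sum>j=k..<m. qvar ^ (4 * j + 4) / (1 - qvar ^ (4 * j + 4)) ^ 2) = harmonic4 m - harmonic4 k"
    using sum.atLeastLessThan_concat[of 0 k m "\<lambda>j. qvar ^ (4 * j + 4) / (1 - qvar ^ (4 * j + 4)) ^ 2"] assms(1)
    by (simp add: harmonic4_def lessThan_atLeast0 eq_diff_eq add.commute)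
  then show "coeff G 1 = - (square4 m / square4 k) * (harmonic4 m - harmonic4 k)"
    unfolding G_def using qvar_power_neq_1 by (subst coeff_1_prod_quad_factor_poly) (auto simp: sq)
qed

lemma coeff_mult_01: "coeff (p * r) 0 = coeff p 0 * coeff r 0"
    "coeff (p * r) 1 = coeff p 0 * coeff r 1 + coeff p 1 * coeff r 0"
  by (simp_all add: coeff_mult)

text \<open>
  The common denominator contributes \<open>- harmonic4 m\<close> to every logarithmic derivative. Adding \<open>harmonic4 m\<close> times
  the constant coefficient removes this contribution, which would otherwise appear in each summand.
\<close>

lemma coeffs_mixed_poly:
  assumes "k \<le> m"
  shows "coeff (mixed_poly m k) 1 + harmonic4 m * coeff (mixed_poly m k) 0
     = - square4 m * (square_odd k / square4 k) * (harmonic_odd k - harmonic4 k)"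
proof -
  have "coeff (\<Prod>j<k. quad_factor_poly (qvar ^ (2 * j + 1))) 1 = - square_odd k * harmonic_odd k"
    unfolding square_odd_def harmonic_odd_def
    by (intro coeff_1_prod_quad_factor_poly qvar_power_neq_1) simp
  moreover have "coeff (\<Prod>j<k. quad_factor_poly (qvar ^ (2 * j + 1))) 0 = square_odd k"
    unfolding coeff_0_prod_quad_factor_poly square_odd_def ..
  ultimately show ?thesis
    unfolding mixed_poly_def coeff_mult_01 coeffs_tail_poly[OF assms]
    by (simp add: algebra_simps add_divide_distrib diff_divide_distrib)
qed

text \<open>
  The linear coefficient of \<open>difference_poly\<close>, corrected by \<open>harmonic4 m\<close> times the constant one and divided by the
  unit \<open>- square4 m\<close>.
\<close>

lemma weighted_sum_congruence:
  assumes n: "n + 1 = 4 * M" "n = 2 * m + 1"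
  shows "(\<Sum>k\<le>m. x_free_term k * (square_odd k / square4 k) * (harmonic_odd k - harmonic4 k))
          + closed_numerator M / square4 M * harmonic4 M \<in> power_ideal (cyclotomic n) 2"
proof -
  let ?P = "cyclotomic n"
  let ?h = "difference_poly M m"
  let ?t = "(\<Sum>k\<le>m. x_free_term k * (square_odd k / square4 k) * (harmonic_odd k - harmonic4 k))
          + closed_numerator M / square4 M * harmonic4 M"
  have n0: "n > 0" and Mm: "M \<le> m" and odd: "odd n" using n by presburger+
  have u: "1 - qvar ^ (4 * j + 4) \<in> local_units ?P" if "j < m" for j
    using odd_not_dvd_even[of n "4 * j + 4"] one_minus_qvar_power_unit[OF n0, of "4 * j + 4"] odd n that by simp
  have S: "square4 m \<in> local_units ?P"
    unfolding square4_def using u by (intro local_unit_prod local_unit_power) auto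
  have H: "harmonic4 m \<in> localized ?P"
    unfolding harmonic4_def using u by (intro localized_sum localized_divide localized_power local_unit_power qvar_localized) auto
  have "coeff ?h 1 + harmonic4 m * coeff ?h 0
      = (\<Sum>k\<le>m. x_free_term k * (coeff (mixed_poly m k) 1 + harmonic4 m * coeff (mixed_poly m k) 0))
        - closed_numerator M * (- square4 m / square4 M * (harmonic4 m - harmonic4 M) + harmonic4 m * (square4 m / square4 M))"
    unfolding difference_poly_def coeff_diff coeff_sum coeff_smult coeffs_tail_poly[OF Mm]
    by (simp add: algebra_simps sum.distrib sum_distrib_left)
  also have "(\<Sum>k\<le>m. x_free_term k * (coeff (mixed_poly m k) 1 + harmonic4 m * coeff (mixed_poly m k) 0))
      = - square4 m * (\<Sum>k\<le>m. x_free_term k * (square_odd k / square4 k) * (harmonic_odd k - harmonic4 k))"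
    unfolding sum_distrib_left
    by (intro sum.cong refl) (simp add: coeffs_mixed_poly del: One_nat_def)
  also have "\<dots> - closed_numerator M * (- square4 m / square4 M * (harmonic4 m - harmonic4 M) + harmonic4 m * (square4 m / square4 M))
      = - square4 m * ?t"
    by (simp add: algebra_simps add_divide_distrib diff_divide_distrib)
  finally have "?t = - (coeff ?h 1 + harmonic4 m * coeff ?h 0) / square4 m"
    using square4_nonzero[of m] by (simp add: field_simps)
  also have "\<dots> \<in> power_ideal ?P 2"
    using S H coeffs_difference_poly[OF n] by (intro power_ideal_divide power_ideal_uminus power_ideal_add power_ideal_mult_left)
  finally show ?thesis .
qed

section \<open>The congruence for the original sum\<close>

lemma qpoch_qvar:
  "qpoch (qvar ^ a) (qvar ^ b) k = (\<Prod>j<k. 1 - qvar ^ (b * j + a))"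
  unfolding qpoch_def by (intro prod.cong refl) (simp add: add.commute flip: power_add power_mult)

lemma sum_qint:
  assumes "d < b"
  shows "(\<Sum>j = 1..k. qvar ^ (b * j - d) / qint qvar (b * j - d) ^ 2)
      = (1 - qvar) ^ 2 * (\<Sum>j<k. qvar ^ (b * j + (b - d)) / (1 - qvar ^ (b * j + (b - d))) ^ 2)"
proof -
  have "(\<Sum>j = 1..k. qvar ^ (b * j - d) / qint qvar (b * j - d) ^ 2)
      = (\<Sum>j<k. qvar ^ (b * Suc j - d) / qint qvar (b * Suc j - d) ^ 2)"
    by (rule sum.reindex_bij_witness[of _ Suc "\<lambda>j. j - 1"]) auto
  also have "\<dots> = (\<Sum>j<k. (1 - qvar) ^ 2 * (qvar ^ (b * j + (b - d)) / (1 - qvar ^ (b * j + (b - d))) ^ 2))"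
  proof (intro sum.cong refl)
    fix j
    have "b * Suc j - d = b * j + (b - d)"
      using assms by simp
    then show "qvar ^ (b * Suc j - d) / qint qvar (b * Suc j - d) ^ 2
       = (1 - qvar) ^ 2 * (qvar ^ (b * j + (b - d)) / (1 - qvar ^ (b * j + (b - d))) ^ 2)"
      by (simp add: qint_def power_divide)
  qed
  finally show ?thesis
    by (simp add: sum_distrib_left)
qed

text \<open>
  The \<open>q\<close>-integer contributes the factor \<open>1 / (1 - q)\<close>. The factor \<open>q\<^bsup>3k\<^esup>\<close> is \<open>q\<^bsup>2k\<^esup>\<close> from
  \<open>base_coeff\<close> and \<open>q\<^sup>k\<close> from writing \<open>q - q\<^bsup>4j\<^esup>\<close> as \<open>q (1 - q\<^bsup>4j-1\<^esup>)\<close>.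
\<close>

lemma summand_normal_form:
  "qint qvar (6 * k + 1) * (qpoch qvar (qvar ^ 2) k ^ 3 * qpoch (inverse qvar) (qvar ^ 4) k)
         / (qpoch (qvar ^ 4) (qvar ^ 4) k ^ 3 * qpoch (qvar ^ 4) (qvar ^ 2) k) * qvar ^ (k ^ 2 + 3 * k)
   = x_free_term k * (square_odd k / square4 k) / (1 - qvar)"
proof -
  have q0: "qvar \<noteq> 0"
    using local_unit_nonzero[OF qvar_unit[of 1]] by simp
  have odd: "square_odd k = qpoch qvar (qvar ^ 2) k ^ 2"
    using qpoch_qvar[of 1 2 k] by (simp only: square_odd_def power_one_right prod_power_distrib)
  have four: "square4 k = qpoch (qvar ^ 4) (qvar ^ 4) k ^ 2"
    by (simp only: square4_def qpoch_qvar prod_power_distrib)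
  have "(\<Prod>j<k. qvar - qvar ^ (4 * j)) = (\<Prod>j<k. qvar * (1 - inverse qvar * (qvar ^ 4) ^ j))"
    using q0 by (intro prod.cong refl) (simp add: right_diff_distrib power_mult)
  also have "\<dots> = qvar ^ k * qpoch (inverse qvar) (qvar ^ 4) k"
    by (simp add: prod.distrib qpoch_def)
  finally have num: "(\<Prod>j<k. qvar - qvar ^ (4 * j)) = qvar ^ k * qpoch (inverse qvar) (qvar ^ 4) k" .
  have den: "(\<Prod>j<k. 1 - qvar * qvar ^ (2 * j + 3)) = qpoch (qvar ^ 4) (qvar ^ 2) k"
    unfolding qpoch_qvar by (intro prod.cong refl) (simp add: numeral_eq_Suc)
  have "qvar ^ (k ^ 2 + 3 * k) = qvar ^ (k ^ 2 + 2 * k) * qvar ^ k"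
    by (simp add: add.commute flip: power_add)
  then show ?thesis
    unfolding x_free_term_def base_coeff_def num den odd four qint_def
    by (simp add: divide_inverse power2_eq_square power3_eq_cube mult_ac)
qed

theorem theorem2:
  fixes n :: nat and q :: ratfun
  defines "q \<equiv> qvar"
  assumes "n > 0" and "odd n" and "[n = 3] (mod 4)"
  shows "ratfun_cong
    (\<Sum>k = 0..(n - 1) div 2.
       qint q (6 * k + 1)
         * (qpoch q (q ^ 2) k ^ 3 * qpoch (inverse q) (q ^ 4) k)
         / (qpoch (q ^ 4) (q ^ 4) k ^ 3 * qpoch (q ^ 4) (q ^ 2) k)
         * q ^ (k ^ 2 + 3 * k)
         * ((\<Sum>j = 1..k. q ^ (2 * j - 1) / qint q (2 * j - 1) ^ 2)
            - (\<Sum>j = 1..k. q ^ (4 * j) / qint q (4 * j) ^ 2)))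
    (- ((qpoch (q ^ 3) (q ^ 4) ((n + 1) div 4) * qpoch (q ^ 5) (q ^ 4) ((n + 1) div 4))
         / qpoch (q ^ 4) (q ^ 4) ((n + 1) div 4) ^ 2)
       * (\<Sum>j = 1..(n + 1) div 4. q ^ (4 * j) / qint q (4 * j) ^ 2))
    (cyclotomic n ^ 2)"
proof -
  let ?P = "cyclotomic n"
  define m where "m = (n - 1) div 2"
  define M where "M = (n + 1) div 4"
  have "n mod 4 = 3"
    using assms(4) by (simp add: cong_def)
  then have n: "n + 1 = 4 * M" "n = 2 * m + 1"
    unfolding M_def m_def by presburger+
  have q1: "1 - qvar \<noteq> 0"
    using qvar_power_neq_1[of 1] by simp
  have odd: "(\<Sum>j = 1..k. qvar ^ (2 * j - 1) / qint qvar (2 * j - 1) ^ 2) = (1 - qvar) ^ 2 * harmonic_odd k" for k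
    using sum_qint[where b = 2 and d = 1] by (simp add: harmonic_odd_def)
  have four: "(\<Sum>j = 1..k. qvar ^ (4 * j) / qint qvar (4 * j) ^ 2) = (1 - qvar) ^ 2 * harmonic4 k" for k
    using sum_qint[where b = 4 and d = 0] by (simp add: harmonic4_def)
  let ?w = "\<lambda>k. x_free_term k * (square_odd k / square4 k)"
  have sq: "(1 - qvar) ^ 2 = (1 - qvar) * (1 - qvar)"
    by (simp add: power2_eq_square)
  have "(\<Sum>k = 0..m.
       qint qvar (6 * k + 1)
         * (qpoch qvar (qvar ^ 2) k ^ 3 * qpoch (inverse qvar) (qvar ^ 4) k)
         / (qpoch (qvar ^ 4) (qvar ^ 4) k ^ 3 * qpoch (qvar ^ 4) (qvar ^ 2) k)
         * qvar ^ (k ^ 2 + 3 * k)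
         * ((\<Sum>j = 1..k. qvar ^ (2 * j - 1) / qint qvar (2 * j - 1) ^ 2)
            - (\<Sum>j = 1..k. qvar ^ (4 * j) / qint qvar (4 * j) ^ 2)))
     = (1 - qvar) * (\<Sum>k\<le>m. ?w k * (harmonic_odd k - harmonic4 k))"
    unfolding summand_normal_form odd four sum_distrib_left atMost_atLeast0
    using q1 by (intro sum.cong refl) (simp add: sq flip: right_diff_distrib)
  moreover have "(qpoch (qvar ^ 3) (qvar ^ 4) M * qpoch (qvar ^ 5) (qvar ^ 4) M) / qpoch (qvar ^ 4) (qvar ^ 4) M ^ 2
       * (\<Sum>j = 1..M. qvar ^ (4 * j) / qint qvar (4 * j) ^ 2)
     = (1 - qvar) * (closed_numerator M / square4 M * harmonic4 M)"
    unfolding four closed_numerator_def square4_def qpoch_qvar prod_power_distrib prod.distrib sq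
    by (simp only: divide_inverse mult_ac)
  (* The squares of q-integers give (1 - q)^2, and one of these factors cancels against 1 - q in the
     denominator of the q-integer of 6 k + 1 on the left, or is part of closed_numerator on the right. *)
  ultimately have "(\<Sum>k = 0..m.
       qint qvar (6 * k + 1)
         * (qpoch qvar (qvar ^ 2) k ^ 3 * qpoch (inverse qvar) (qvar ^ 4) k)
         / (qpoch (qvar ^ 4) (qvar ^ 4) k ^ 3 * qpoch (qvar ^ 4) (qvar ^ 2) k)
         * qvar ^ (k ^ 2 + 3 * k)
         * ((\<Sum>j = 1..k. qvar ^ (2 * j - 1) / qint qvar (2 * j - 1) ^ 2)
            - (\<Sum>j = 1..k. qvar ^ (4 * j) / qint qvar (4 * j) ^ 2)))
     - (- ((qpoch (qvar ^ 3) (qvar ^ 4) M * qpoch (qvar ^ 5) (qvar ^ 4) M) / qpoch (qvar ^ 4) (qvar ^ 4) M ^ 2)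
       * (\<Sum>j = 1..M. qvar ^ (4 * j) / qint qvar (4 * j) ^ 2))
     = (1 - qvar) * ((\<Sum>k\<le>m. ?w k * (harmonic_odd k - harmonic4 k)) + closed_numerator M / square4 M * harmonic4 M)"
    by (simp only: mult_minus_left diff_minus_eq_add distrib_left)
  also have "\<dots> \<in> power_ideal ?P 2"
    by (intro power_ideal_mult_left weighted_sum_congruence n localized_diff localized_1 qvar_localized)
  finally show ?thesis
    unfolding q_def m_def[symmetric] M_def[symmetric] by (intro power_ideal_imp_cong cyclotomic_nonzero)
qed

end
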